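(* Let $G$ be a finite simple graph of order $n\geq 5$ whose adjacency matrix $A(G)$ is non-singular, and suppose its largest adjacency eigenvalue satisfies $\lambda_1\leq 7.11$. Then $\mathcal{E}(G)\geq n-1+\bar{d}$.
   Context: For a finite simple graph $G$ with $n$ vertices and $m$ edges, $A(G)$ is its adjacency matrix with eigenvalues $\lambda_1\ge\cdots\ge\lambda_n$, and the energy is $\mathcal{E}(G)=\sum_{i=1}^n|\lambda_i|$. $G$ is non-singular if $A(G)$ is non-singular. $\bar d=2m/n$ is the average degree. *)

theory Defs
  imports "Jordan_Normal_Form.Char_Poly" "Jordan_Normal_Form.Determinant"
begin

definition simple_graph :: "nat \<Rightarrow> (nat \<Rightarrow> nat \<Rightarrow> bool) \<Rightarrow> bool" where
  "simple_graph n E \<longleftrightarrow> (\<forall>i<n. \<forall>j<n. E i j \<longleftrightarrow> E j i) \<and> (\<forall>i<n. \<not> E i i)"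

definition adj_mat :: "nat \<Rightarrow> (nat \<Rightarrow> nat \<Rightarrow> bool) \<Rightarrow> real mat" where
  "adj_mat n E = mat n n (\<lambda>(i, j). if E i j then 1 else 0)"

definition num_edges :: "nat \<Rightarrow> (nat \<Rightarrow> nat \<Rightarrow> bool) \<Rightarrow> nat" where
  "num_edges n E = card {(i, j). i < j \<and> j < n \<and> E i j}"

definition avg_degree :: "nat \<Rightarrow> (nat \<Rightarrow> nat \<Rightarrow> bool) \<Rightarrow> real" where
  "avg_degree n E = 2 * real (num_edges n E) / real n"

definition eigenvalues :: "real mat \<Rightarrow> real list" where
  "eigenvalues A = (THE es. sorted_wrt (\<ge>) es \<and>
      char_poly A = (\<Prod>a\<leftarrow>es. [:- a, 1:]))"

definition largest_eigenvalue :: "real mat \<Rightarrow> real" where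
  "largest_eigenvalue A = hd (eigenvalues A)"

definition energy :: "real mat \<Rightarrow> real" where
  "energy A = (\<Sum>x\<leftarrow>eigenvalues A. \<bar>x\<bar>)"

end

theory Submission
  imports Defs
begin

text \<open>
  Write \<open>t\<close> for the average degree and \<open>r\<close> for the largest eigenvalue. The eigenvalues have sum \<open>0\<close> and square sum
  \<open>n t\<close>, the absolute value of their product is a positive integer, and \<open>t \<le> r\<close>. Tangent inequalities
  \<open>\<bar>x\<bar> \<ge> c + \<gamma> x + \<alpha> ln \<bar>x\<bar> + \<beta> x\<^sup>2\<close>, summed over the spectrum, turn this information into lower bounds for the
  energy. For \<open>n \<ge> 11\<close> the choice \<open>\<gamma> = 0\<close>, \<open>\<beta> = 1 / 11\<close>, which is valid up to \<open>7.11\<close>, suffices.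

  For \<open>5 \<le> n \<le> 10\<close> the same method works with \<open>r\<close> treated separately, given some arithmetic. The complete graph is
  clear since the energy is at least \<open>2 r\<close>. Otherwise four vertices span a block of determinant \<open>1\<close> with signature
  \<open>(2, 2)\<close>, so there is a second positive eigenvalue. If \<open>n\<close> is odd, the determinant is even. If \<open>n = 6\<close> or \<open>n = 8\<close> and there is
  no third positive eigenvalue, then the Schur complement of the block is an even negative definite integral form
  of rank \<open>n - 4\<close> with the same determinant, and this forces the determinant to be at least \<open>3\<close>.
\<close>

section \<open>Lower bounds for sums of absolute values\<close>

text \<open>Equality holds for perfect matchings, where every eigenvalue is 1 or -1, and for
  complete graphs, where \<open>r = n - 1\<close>, so there is little room at either end of the
  range of \<open>r\<close>. A tangent at 1 with \<open>\<beta> = 1 / n\<close> cancels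
  \<open>t\<close> and is exact for matchings, but it is valid only as far as
  \<open>(n - 2) ln r \<le> (r - 1) (n - 1 - r)\<close>. Up to order 10 the larger radii call for
  sharper data: the trace, which enters through \<open>\<gamma>\<close>, the number of positive
  eigenvalues, and the determinant. As the trace is 0, a negative \<open>\<gamma>\<close> credits
  \<open>r\<close> and every other positive eigenvalue at the expense of the negative ones; this is
  why further positive eigenvalues pay off.

  The block exists because two nonadjacent vertices of a nonsingular graph are not twins and not
  isolated. One of its vertices has a single neighbour inside the block; removing these two leaves
  an edge, so the determinant is \<open>(-1) * (-1)\<close>, whatever the remaining edges are. Hence
  the inverse of the block is integral, and the Schur complement is the form on the orthogonal
  lattice, even because adjacency matrices have zero diagonal.\<close>

lemma exp_ge_cubic: "1 + x + x\<^sup>2 / 2 + x ^ 3 / 6 \<le> exp (x::real)"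
proof -
  obtain s where "exp x = (\<Sum>m<4. x ^ m / fact m) + exp s / fact 4 * x ^ 4"
    using Maclaurin_exp_le[of x 4] by blast
  \<comment> \<open>The remainder has even order, so the sign of \<open>x\<close> does not
    matter.\<close>
  moreover have "0 \<le> exp s / fact 4 * x ^ 4"
    by simp
  ultimately show ?thesis
    by (simp add: eval_nat_numeral)
qed

text \<open>A rational lower bound for \<open>exp q\<close>. Scaling the argument down by 16 keeps
  the Taylor error small, and \<open>simp\<close> can evaluate the result at rational
  numbers.\<close>

definition exp_lower :: "real \<Rightarrow> real" where
  "exp_lower q = (1 + q / 16 + (q / 16)\<^sup>2 / 2 + (q / 16) ^ 3 / 6) ^ 16"

lemma ln_le_of_le_exp_lower:
  fixes z q :: real
  assumes "0 < z" and "-16 \<le> q" and "z \<le> exp_lower q"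
  shows "ln z \<le> q"
proof -
  let ?c = "1 + q / 16 + (q / 16)\<^sup>2 / 2 + (q / 16) ^ 3 / 6"
  \<comment> \<open>For \<open>x = q / 16 \<ge> -1\<close> both summands of
    \<open>(1 + x) + x^2 (3 + x) / 6\<close> are nonnegative, and \<open>power_mono\<close> needs a
    nonnegative base.\<close>
  have "0 \<le> (1 + q / 16) + (q / 16)\<^sup>2 * ((3 + q / 16) / 6)"
    using assms(2) by (intro add_nonneg_nonneg[of "1 + q / 16"] mult_nonneg_nonneg) auto
  also have "\<dots> = ?c"
    by (simp add: field_simps power2_eq_square power3_eq_cube)
  finally have "?c ^ 16 \<le> exp (q / 16) ^ 16"
    by (intro power_mono exp_ge_cubic)
  also have "\<dots> = exp q"
    by (simp flip: exp_of_nat_mult)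
  finally have "z \<le> exp q"
    using assms(3) unfolding exp_lower_def by linarith
  then show ?thesis
    using assms(1) by (metis exp_gt_zero ln_exp ln_mono)
qed

section \<open>Tangent inequalities with a logarithm and a square\<close>

text \<open>The difference \<open>G\<close> vanishes at 1; it falls up to 1, rises up to
  \<open>1 / (2 k)\<close> and falls beyond that point, if at all. Its minimum up to
  \<open>U\<close> is therefore at 1 or at \<open>U\<close>, and one numerical condition at
  \<open>U\<close> suffices.\<close>

lemma ln_le_quadratic:
  fixes u U k :: real
  assumes "0 < u" "u \<le> U" "1 \<le> U" "0 \<le> k" "k \<le> 1 / 2"
    and U: "ln U \<le> U - 1 - k * (U - 1)\<^sup>2"
  shows "ln u \<le> u - 1 - k * (u - 1)\<^sup>2"
proof -
  define G where "G x = x - 1 - k * (x - 1)\<^sup>2 - ln x" for x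
  have D: "(G has_real_derivative (x - 1) * (1 - 2 * k * x) / x) (at x)" if "0 < x" for x
    unfolding G_def using that
    by (auto intro!: derivative_eq_intros simp: field_simps power2_eq_square)
  have "0 \<le> G u"
  proof (cases "u \<le> 1")
    case True
    have "G u \<ge> G 1"
    proof (rule DERIV_nonpos_imp_nonincreasing[OF True], intro exI conjI)
      fix x assume x: "u \<le> x" "x \<le> 1"
      then have "0 < x" "2 * k * x \<le> 1"
        using assms mult_mono[of "2 * k" 1 x 1] by auto
      then show "(x - 1) * (1 - 2 * k * x) / x \<le> 0"
        using x by (intro divide_nonpos_pos mult_nonpos_nonneg) auto
      show "(G has_real_derivative (x - 1) * (1 - 2 * k * x) / x) (at x)"
        using D \<open>0 < x\<close> .
    qed
    then show ?thesis by (simp add: G_def)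
  next
    case u1: False
    show ?thesis
    proof (cases "2 * k * u \<le> 1")
      case True
      have "G 1 \<le> G u"
      proof (rule DERIV_nonneg_imp_nondecreasing, use u1 in simp, intro exI conjI)
        fix x assume x: "1 \<le> x" "x \<le> u"
        then have "2 * k * x \<le> 2 * k * u"
          using assms(4) by (intro mult_left_mono) auto
        then show "0 \<le> (x - 1) * (1 - 2 * k * x) / x"
          using x True by (intro divide_nonneg_pos mult_nonneg_nonneg) auto
        show "(G has_real_derivative (x - 1) * (1 - 2 * k * x) / x) (at x)"
          using D x by simp
      qed
      then show ?thesis by (simp add: G_def)
    next
      case False
      have "G u \<ge> G U"
      proof (rule DERIV_nonpos_imp_nonincreasing[OF assms(2)], intro exI conjI)
        fix x assume x: "u \<le> x" "x \<le> U"
        then have "2 * k * u \<le> 2 * k * x"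
          using assms(4) by (intro mult_left_mono) auto
        then show "(x - 1) * (1 - 2 * k * x) / x \<le> 0"
          using x u1 False by (intro divide_nonpos_pos mult_nonneg_nonpos) auto
        show "(G has_real_derivative (x - 1) * (1 - 2 * k * x) / x) (at x)"
          using D x assms(1) by simp
      qed
      then show ?thesis using U by (simp add: G_def)
    qed
  qed
  then show ?thesis by (simp add: G_def)
qed

text \<open>The formula for \<open>a\<close> makes \<open>x0\<close> a critical point of the
  right-hand side, and condition \<open>k\<close> makes the second derivative there nonnegative.
  Putting \<open>x = u * x0\<close> reduces the claim to \<open>ln_le_quadratic\<close>;
  \<open>q\<close> is a rational stand-in for the logarithm at the right end
  \<open>M\<close>.\<close>

lemma log_quadratic_min:
  fixes x x0 M \<alpha> \<beta> a q :: real
  assumes x: "0 < x" "x \<le> M" and x0: "0 < x0" "x0 \<le> M" and "0 < \<alpha>" "0 \<le> \<beta>"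
    and a: "a = \<alpha> / x0 + 2 * \<beta> * x0"
    and k: "2 * \<beta> * x0\<^sup>2 \<le> \<alpha>"
    and q: "ln (M / x0) \<le> q" "\<alpha> * q \<le> \<alpha> * (M / x0 - 1) - \<beta> * (M - x0)\<^sup>2"
  shows "\<alpha> + \<beta> * x0\<^sup>2 - \<alpha> * ln x0 \<le> a * x - \<alpha> * ln x - \<beta> * x\<^sup>2"
proof -
  let ?k = "\<beta> * x0\<^sup>2 / \<alpha>"
  have "\<alpha> * q \<le> \<alpha> * (M / x0 - 1 - ?k * (M / x0 - 1)\<^sup>2)"
  proof -
    define w where "w = M / x0 - 1"
    have w: "x0 * w = M - x0"
      using x0 by (simp add: w_def right_diff_distrib)
    have "\<alpha> * (w - ?k * w\<^sup>2) = \<alpha> * w - \<beta> * (M - x0)\<^sup>2"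
      using assms(5) by (simp add: w[symmetric] right_diff_distrib power_mult_distrib)
    then show ?thesis using q(2) by (simp add: w_def)
  qed
  then have "q \<le> M / x0 - 1 - ?k * (M / x0 - 1)\<^sup>2"
    using assms(5) by simp
  then have "ln (M / x0) \<le> M / x0 - 1 - ?k * (M / x0 - 1)\<^sup>2"
    using q(1) by linarith
  moreover have "0 \<le> ?k" "?k \<le> 1 / 2" "0 < x / x0" "x / x0 \<le> M / x0" "1 \<le> M / x0"
    using x x0 k assms(5,6) by (auto simp: divide_simps)
  ultimately have "ln (x / x0) \<le> x / x0 - 1 - ?k * (x / x0 - 1)\<^sup>2"
    by (metis ln_le_quadratic)
  then have "\<alpha> * ln (x / x0) \<le> \<alpha> * (x / x0 - 1 - ?k * (x / x0 - 1)\<^sup>2)"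
    using assms(5) by (intro mult_left_mono) auto
  also have "\<dots> = a * x - \<beta> * x\<^sup>2 - \<alpha> - \<beta> * x0\<^sup>2"
  proof -
    define u where "u = x / x0"
    have x_eq: "x = u * x0" and ax0: "a * x0 = \<alpha> + 2 * \<beta> * x0\<^sup>2"
      using x0 by (auto simp: u_def a distrib_right power2_eq_square)
    have "\<alpha> * (u - 1 - ?k * (u - 1)\<^sup>2) = \<alpha> * u - \<alpha> - \<beta> * x0\<^sup>2 * (u - 1)\<^sup>2"
      using assms(5) by (simp add: right_diff_distrib)
    also have "\<dots> = u * (a * x0) - \<beta> * x\<^sup>2 - \<alpha> - \<beta> * x0\<^sup>2"
      unfolding ax0 x_eq by (simp add: algebra_simps power2_eq_square)
    finally show ?thesis
      by (simp add: u_def[symmetric]) (simp add: x_eq mult_ac)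
  qed
  finally show ?thesis
    using x x0 by (simp add: ln_div algebra_simps)
qed

lemma concave_quadratic_ge:
  fixes a b x y z c :: real
  assumes "x \<le> z" "z \<le> y" "0 \<le> b" "c \<le> a * x - b * x\<^sup>2" "c \<le> a * y - b * y\<^sup>2"
  shows "c \<le> a * z - b * z\<^sup>2"
proof (cases "x = y")
  case True
  then show ?thesis using assms by auto
next
  case False
  then have "0 < y - x" using assms by simp
  have "(y - z) * c \<le> (y - z) * (a * x - b * x\<^sup>2)" "(z - x) * c \<le> (z - x) * (a * y - b * y\<^sup>2)"
    using assms by (auto intro!: mult_left_mono)
  \<comment> \<open>The excess of the quadratic over its chord at \<open>z\<close> is
    \<open>b (z - x) (y - z)\<close>.\<close>
  moreover have "0 \<le> (y - x) * (b * ((z - x) * (y - z)))"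
    using assms by (intro mult_nonneg_nonneg) auto
  ultimately have "(y - x) * c \<le> (y - x) * (a * z - b * z\<^sup>2)"
    by (simp add: algebra_simps power2_eq_square)
  then show ?thesis using \<open>0 < y - x\<close> by simp
qed

lemma ln_le_tangent: "0 < c \<Longrightarrow> 0 < x \<Longrightarrow> ln x \<le> ln c + x / c - (1::real)"
  using ln_le_minus_one[of "x / c"] by (simp add: ln_div)

section \<open>Energy bounds from trace, square sum and determinant\<close>

text \<open>All that the analytic part sees of a graph. \<open>D\<close> is a known lower bound for
  the absolute determinant; it is a parameter so that the same estimates serve for 1 and for the
  improved values 2 and 3.\<close>

locale graph_spectrum =
  fixes n :: nat and lam :: "nat \<Rightarrow> real" and i0 :: nat and t D :: real
  assumes i0: "i0 < n"
    and sum_zero: "(\<Sum>i<n. lam i) = 0"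
    and sum_sq: "(\<Sum>i<n. (lam i)\<^sup>2) = n * t"
    and D: "1 \<le> D" "D \<le> (\<Prod>i<n. \<bar>lam i\<bar>)"
    and t_le: "t \<le> lam i0"
    and abs_le: "\<And>i. i < n \<Longrightarrow> \<bar>lam i\<bar> \<le> lam i0"
begin

abbreviation "r \<equiv> lam i0"

lemma nonzero: "i < n \<Longrightarrow> lam i \<noteq> 0"
  using D prod_zero[of "{..<n}" "\<lambda>i. \<bar>lam i\<bar>"] by fastforce

lemma r_ge_1: "1 \<le> r"
proof (rule ccontr)
  assume "\<not> 1 \<le> r"
  then have "(\<Prod>i<n. \<bar>lam i\<bar>) < (\<Prod>i<n. 1::real)"
    using i0 abs_le nonzero by (intro prod_mono_strict[of i0]) force+
  then show False using D by simp
qed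

lemma sum_split: "(\<Sum>i<n. f i) = f i0 + (\<Sum>i\<in>{..<n} - {i0}. f i)" for f :: "nat \<Rightarrow> real"
  using i0 by (subst sum.remove[of _ i0]) auto

lemma card_others: "card ({..<n} - {i0}) = n - 1"
  using i0 by simp

lemma lam_sq_le: "i < n \<Longrightarrow> i \<noteq> i0 \<Longrightarrow> (lam i)\<^sup>2 \<le> n * r - r\<^sup>2"
proof -
  assume "i < n" "i \<noteq> i0"
  then have "(lam i)\<^sup>2 \<le> (\<Sum>j\<in>{..<n} - {i0}. (lam j)\<^sup>2)"
    by (intro member_le_sum) auto
  moreover have "n * t \<le> n * r"
    using t_le by (intro mult_left_mono) auto
  ultimately show ?thesis
    using sum_split[of "\<lambda>i. (lam i)\<^sup>2"] sum_sq by linarith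
qed

lemma abs_le_bound:
  fixes M :: real
  assumes "i < n" "i \<noteq> i0" "n * r - r\<^sup>2 \<le> M\<^sup>2" "0 \<le> M"
  shows "\<bar>lam i\<bar> \<le> M"
  using lam_sq_le[OF assms(1,2)] assms(3,4) abs_le_square_iff[of "lam i" M] by simp

text \<open>\<open>n * r - r^2\<close> never exceeds \<open>n^2 / 4\<close> and decreases from
  \<open>n / 2\<close> on. So \<open>n / 2\<close> always serves as \<open>M\<close>, and once
  \<open>ra\<close> is at least \<open>n / 2\<close> the value at \<open>ra\<close> gives a better
  bound.\<close>

lemma abs_le_of_radius:
  fixes M ra :: real
  assumes "i < n" "i \<noteq> i0" "ra \<le> r"
    and M: "(real n)\<^sup>2 \<le> 4 * M\<^sup>2 \<or> real n \<le> 2 * ra \<and> n * ra - ra\<^sup>2 \<le> M\<^sup>2" "0 \<le> M"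
  shows "\<bar>lam i\<bar> \<le> M"
proof (rule abs_le_bound[OF assms(1,2)])
  show "n * r - r\<^sup>2 \<le> M\<^sup>2" (is ?le)
    using M(1)
  proof
    assume "(real n)\<^sup>2 \<le> 4 * M\<^sup>2"
    then show ?le
      using zero_le_power2[of "2 * r - real n"] by (simp add: power2_diff power_mult_distrib mult_ac)
  next
    assume ra: "real n \<le> 2 * ra \<and> n * ra - ra\<^sup>2 \<le> M\<^sup>2"
    have "0 \<le> (r - ra) * (r + ra - n)"
      using ra assms(3) by (intro mult_nonneg_nonneg) auto
    then show ?le
      using ra by (simp add: algebra_simps power2_eq_square)
  qed
qed (use M(2) in simp)

text \<open>Cauchy-Schwarz for the other eigenvalues, which have sum \<open>- r\<close> and square
  sum at most \<open>n * r - r^2\<close>. Complete graphs attain the bound.\<close>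

lemma r_le: "n \<ge> 2 \<Longrightarrow> r \<le> real n - 1"
proof -
  assume n: "n \<ge> 2"
  have "(\<Sum>i\<in>{..<n} - {i0}. lam i) = - r"
    using sum_split[of lam] sum_zero by simp
  \<comment> \<open>\<open>- c\<close> is the mean of the other eigenvalues.\<close>
  define c where "c = r / (real n - 1)"
  have "0 \<le> (\<Sum>i\<in>{..<n} - {i0}. (lam i + c)\<^sup>2)"
    by (intro sum_nonneg) auto
  also have "\<dots> = (\<Sum>i\<in>{..<n} - {i0}. (lam i)\<^sup>2) + 2 * c * (\<Sum>i\<in>{..<n} - {i0}. lam i) + (real n - 1) * c\<^sup>2"
    using card_others n by (simp add: power2_sum sum.distrib sum_distrib_left of_nat_diff mult_ac)
  finally have "0 \<le> (real n - 1) * ((\<Sum>i\<in>{..<n} - {i0}. (lam i)\<^sup>2) - r * c)"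
    using \<open>(\<Sum>i\<in>{..<n} - {i0}. lam i) = - r\<close> n by (simp add: c_def power2_eq_square)
  then have "r\<^sup>2 \<le> (real n - 1) * (\<Sum>i\<in>{..<n} - {i0}. (lam i)\<^sup>2)"
    using n by (simp add: c_def right_diff_distrib power2_eq_square)
  also have "\<dots> \<le> (real n - 1) * (n * r - r\<^sup>2)"
  proof (intro mult_left_mono)
    have "n * t \<le> n * r"
      using t_le by (intro mult_left_mono) auto
    then show "(\<Sum>i\<in>{..<n} - {i0}. (lam i)\<^sup>2) \<le> n * r - r\<^sup>2"
      using sum_split[of "\<lambda>i. (lam i)\<^sup>2"] sum_sq by linarith
  qed (use n in simp)
  finally have "(n * r) * r \<le> (n * r) * (real n - 1)"
    by (simp add: algebra_simps power2_eq_square)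
  then show ?thesis
    by (rule mult_left_le_imp_le) (use n r_ge_1 in simp)
qed

text \<open>Here \<open>r\<close> enters exactly and only the other eigenvalues are estimated. The
  square sum leaves a term \<open>(1 - \<beta> n) t\<close>, and \<open>\<beta> n \<le> 1\<close>
  allows \<open>t\<close> to be replaced by \<open>r\<close> in it.\<close>

lemma energy_ge_of_others:
  fixes \<alpha> \<beta> \<gamma> G :: real
  assumes "0 \<le> \<alpha>" "\<beta> * n \<le> 1"
    and G: "G \<le> (\<Sum>i\<in>{..<n} - {i0}. \<bar>lam i\<bar> - \<gamma> * lam i - \<alpha> * ln \<bar>lam i\<bar> - \<beta> * (lam i)\<^sup>2)"
    and fin: "real n - 1 \<le> (\<beta> * n - \<gamma>) * r - \<alpha> * ln r - \<beta> * r\<^sup>2 + G + \<alpha> * ln D"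
  shows "real n - 1 + t \<le> (\<Sum>i<n. \<bar>lam i\<bar>)"
proof -
  let ?g = "\<lambda>i. \<bar>lam i\<bar> - \<gamma> * lam i - \<alpha> * ln \<bar>lam i\<bar> - \<beta> * (lam i)\<^sup>2"
  have "(\<Sum>i<n. ?g i) = (\<Sum>i<n. \<bar>lam i\<bar>) - \<gamma> * (\<Sum>i<n. lam i) - \<alpha> * (\<Sum>i<n. ln \<bar>lam i\<bar>)
      - \<beta> * (\<Sum>i<n. (lam i)\<^sup>2)"
    by (simp add: sum_subtractf sum_distrib_left)
  also have "(\<Sum>i<n. ln \<bar>lam i\<bar>) = ln (\<Prod>i<n. \<bar>lam i\<bar>)"
    using nonzero by (subst ln_prod) auto
  finally have eq: "(\<Sum>i<n. \<bar>lam i\<bar>) = ?g i0 + (\<Sum>i\<in>{..<n} - {i0}. ?g i) + \<alpha> * ln (\<Prod>i<n. \<bar>lam i\<bar>) + \<beta> * (n * t)"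
    using sum_zero sum_sq sum_split[of ?g] by simp
  have "\<alpha> * ln D \<le> \<alpha> * ln (\<Prod>i<n. \<bar>lam i\<bar>)"
    using D assms(1) by (intro mult_left_mono) (auto simp: ln_mono)
  moreover have "(1 - \<beta> * n) * t \<le> (1 - \<beta> * n) * r"
    using t_le assms(2) by (intro mult_left_mono) auto
  ultimately show ?thesis
    using eq G fin r_ge_1 by (simp add: algebra_simps)
qed


text \<open>As \<open>cn \<le> cp\<close>, positive eigenvalues beyond the \<open>kp\<close> known
  ones can only help.\<close>

lemma sum_others_ge:
  fixes cp cn :: real
  assumes kp: "kp \<le> card {i. i < n \<and> i \<noteq> i0 \<and> 0 < lam i}" and "cn \<le> cp"
    and pos: "\<And>i. i < n \<Longrightarrow> i \<noteq> i0 \<Longrightarrow> 0 < lam i \<Longrightarrow> cp \<le> g i"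
    and neg: "\<And>i. i < n \<Longrightarrow> i \<noteq> i0 \<Longrightarrow> lam i < 0 \<Longrightarrow> cn \<le> g i"
  shows "kp * cp + (real n - 1 - kp) * cn \<le> (\<Sum>i\<in>{..<n} - {i0}. g i)"
proof -
  let ?P = "{i. i < n \<and> i \<noteq> i0 \<and> 0 < lam i}"
  have "real kp * (cp - cn) \<le> card ?P * (cp - cn)"
    using assms by (intro mult_right_mono) auto
  also have "\<dots> = (\<Sum>i\<in>?P. cp - cn)"
    by simp
  also have "\<dots> = (\<Sum>i\<in>{..<n} - {i0}. if 0 < lam i then cp - cn else 0)"
    by (intro sum.mono_neutral_cong_left) auto
  also have "\<dots> \<le> (\<Sum>i\<in>{..<n} - {i0}. g i - cn)"
  proof (intro sum_mono)
    fix i assume "i \<in> {..<n} - {i0}"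
    then show "(if 0 < lam i then cp - cn else 0) \<le> g i - cn"
      using pos[of i] neg[of i] nonzero[of i] by (cases "0 < lam i") auto
  qed
  also have "\<dots> = (\<Sum>i\<in>{..<n} - {i0}. g i) - (real n - 1) * cn"
    using i0 by (simp add: sum_subtractf of_nat_diff)
  finally show ?thesis
    by (simp add: algebra_simps)
qed

text \<open>\<open>p\<close> and \<open>y\<close> are the points where the bound is tangent on the positive and on the negative eigenvalues,
  and \<open>c\<close> is the point where \<open>ln r\<close> is linearised. After that only the two ends of the range of \<open>r\<close> matter,
  by concavity.\<close>

lemma energy_ge_certificate:
  fixes \<alpha> \<beta> \<gamma> p y c M qp qy q ra rb :: real
  assumes kp: "kp \<le> card {i. i < n \<and> i \<noteq> i0 \<and> 0 < lam i}"
    and r: "ra \<le> r" "r \<le> rb"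
    and M: "\<And>i. i < n \<Longrightarrow> i \<noteq> i0 \<Longrightarrow> \<bar>lam i\<bar> \<le> M"
    and pos: "0 < \<alpha>" "0 \<le> \<beta>" "\<beta> * n \<le> 1" "0 < p" "p \<le> y" "y \<le> M" "0 < c"
    and tangent: "1 - \<gamma> = \<alpha> / p + 2 * \<beta> * p" "1 + \<gamma> = \<alpha> / y + 2 * \<beta> * y"
    and cmp: "2 * \<beta> * y\<^sup>2 \<le> \<alpha>"
    and qp: "-16 \<le> qp" "M / p \<le> exp_lower qp" "\<alpha> * qp \<le> \<alpha> * (M / p - 1) - \<beta> * (M - p)\<^sup>2"
    and qy: "-16 \<le> qy" "M / y \<le> exp_lower qy" "\<alpha> * qy \<le> \<alpha> * (M / y - 1) - \<beta> * (M - y)\<^sup>2"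
    and q: "-16 \<le> q" "c * p ^ kp * y ^ (n - 1 - kp) / D \<le> exp_lower q"
    and ends: "\<forall>x\<in>{ra, rb}. real n - 1 + \<alpha> * q \<le> \<alpha> + kp * (\<alpha> + \<beta> * p\<^sup>2) + (real n - 1 - kp) * (\<alpha> + \<beta> * y\<^sup>2)
      + ((\<beta> * n - \<gamma> - \<alpha> / c) * x - \<beta> * x\<^sup>2)"
  shows "real n - 1 + t \<le> (\<Sum>i<n. \<bar>lam i\<bar>)"
proof -
  let ?g = "\<lambda>i. \<bar>lam i\<bar> - \<gamma> * lam i - \<alpha> * ln \<bar>lam i\<bar> - \<beta> * (lam i)\<^sup>2"
  define cp cn where "cp = \<alpha> + \<beta> * p\<^sup>2 - \<alpha> * ln p" and "cn = \<alpha> + \<beta> * y\<^sup>2 - \<alpha> * ln y"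
  have y: "0 < y" "0 < M" using pos by auto
  have p2: "p\<^sup>2 \<le> y\<^sup>2" using pos by (intro power_mono) auto
  have "2 * \<beta> * p\<^sup>2 \<le> 2 * \<beta> * y\<^sup>2" using pos p2 by (intro mult_left_mono) auto
  then have p2a: "2 * \<beta> * p\<^sup>2 \<le> \<alpha>" using cmp by linarith
  have lnp: "ln (M / p) \<le> qp" and lny: "ln (M / y) \<le> qy"
    using qp qy pos y by (auto intro!: ln_le_of_le_exp_lower)
  \<comment> \<open>Moving the tangent point from \<open>y\<close> down to \<open>p\<close> gains
    \<open>\<alpha> ln (y / p) \<ge> \<alpha> (1 - p / y)\<close> and costs
    \<open>\<beta> (y^2 - p^2)\<close>, which \<open>cmp\<close> keeps below that gain.\<close>
  have "cn \<le> cp"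
  proof -
    have "\<beta> * (y\<^sup>2 - p\<^sup>2) = \<beta> * (y + p) * (y - p)"
      by (simp add: algebra_simps power2_eq_square)
    also have "\<dots> \<le> (\<beta> * (2 * y)) * (y - p)"
      using pos by (intro mult_right_mono mult_left_mono) auto
    also have "\<beta> * (2 * y) \<le> \<alpha> / y"
      using cmp y by (simp add: field_simps power2_eq_square)
    then have "(\<beta> * (2 * y)) * (y - p) \<le> \<alpha> / y * (y - p)"
      using pos by (intro mult_right_mono) auto
    also have "\<dots> = \<alpha> * (1 - p / y)"
      using y by (simp add: field_simps)
    also have "\<dots> \<le> \<alpha> * (ln y - ln p)"
      using ln_le_tangent[of y p] pos y by (intro mult_left_mono) auto
    finally show ?thesis
      by (simp add: cp_def cn_def algebra_simps)
  qed
  have le: "kp < n"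
  proof -
    have "card {i. i < n \<and> i \<noteq> i0 \<and> 0 < lam i} \<le> card ({..<n} - {i0})"
      by (intro card_mono) auto
    then show ?thesis using kp i0 card_others by auto
  qed
  have G: "kp * cp + (real n - 1 - kp) * cn \<le> sum ?g ({..<n} - {i0})"
  proof (intro sum_others_ge[OF kp \<open>cn \<le> cp\<close>])
    fix i assume i: "i < n" "i \<noteq> i0" "0 < lam i"
    then show "cp \<le> ?g i"
      using log_quadratic_min[of "lam i" M p \<alpha> \<beta> "1 - \<gamma>" qp, OF _ _ _ _ _ _ tangent(1) p2a lnp qp(3)]
        M[of i] pos by (simp add: cp_def left_diff_distrib)
  next
    fix i assume i: "i < n" "i \<noteq> i0" "lam i < 0"
    then show "cn \<le> ?g i"
      using log_quadratic_min[of "- lam i" M y \<alpha> \<beta> "1 + \<gamma>" qy, OF _ _ _ _ _ _ tangent(2) cmp lny qy(3)]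
        M[of i] pos y by (simp add: cn_def distrib_right)
  qed
  \<comment> \<open>The logarithms share the factor \<open>\<alpha>\<close>, so one rational bound
    for the logarithm of a product replaces them all.\<close>
  have "ln (c * p ^ kp * y ^ (n - 1 - kp) / D) \<le> q"
    using q pos y D by (intro ln_le_of_le_exp_lower) auto
  also have "ln (c * p ^ kp * y ^ (n - 1 - kp) / D) = ln c + kp * ln p + (real n - 1 - kp) * ln y - ln D"
    using pos y D le by (simp add: ln_mult ln_div ln_realpow of_nat_diff)
  finally have lnq: "\<alpha> * (ln c + kp * ln p + (real n - 1 - kp) * ln y - ln D) \<le> \<alpha> * q"
    using pos by (intro mult_left_mono) auto
  have lnr: "\<alpha> * ln r \<le> \<alpha> * (ln c + r / c - 1)"
    using ln_le_tangent[of c r] pos r_ge_1 by (intro mult_left_mono) auto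
  define K where "K = kp * (\<alpha> + \<beta> * p\<^sup>2) + (real n - 1 - kp) * (\<alpha> + \<beta> * y\<^sup>2) + \<alpha> - \<alpha> * q - (real n - 1)"
  have "- K \<le> (\<beta> * n - \<gamma> - \<alpha> / c) * r - \<beta> * r\<^sup>2"
    using ends pos by (intro concave_quadratic_ge[OF r]) (auto simp: K_def)
  then have "real n - 1 \<le> (\<beta> * n - \<gamma>) * r - \<alpha> * ln r - \<beta> * r\<^sup>2 + (kp * cp + (real n - 1 - kp) * cn) + \<alpha> * ln D"
    using lnr lnq by (simp add: K_def cp_def cn_def algebra_simps)
  then show ?thesis
    using energy_ge_of_others[OF _ pos(3) G] pos by simp
qed

text \<open>One further eigenvalue is far from the tangent point and is treated apart, like
  \<open>r\<close>: its logarithm is linearised at \<open>y\<close>, and by concavity only the ends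
  \<open>Y\<close> and \<open>M\<close> of its range matter. The remaining ones share the tangent
  point \<open>x\<close>, with \<open>\<gamma> = 0\<close>.\<close>

lemma energy_ge_certificate_large:
  fixes \<alpha> \<beta> x y c M qx q ra rb Y :: real
  assumes i1: "i1 < n" "i1 \<noteq> i0" "Y \<le> \<bar>lam i1\<bar>"
    and r: "ra \<le> r" "r \<le> rb"
    and M: "\<And>i. i < n \<Longrightarrow> i \<noteq> i0 \<Longrightarrow> \<bar>lam i\<bar> \<le> M"
    and pos: "0 < \<alpha>" "0 \<le> \<beta>" "\<beta> * n \<le> 1" "0 < x" "x \<le> M" "0 < c" "0 < y"
    and tangent: "1 = \<alpha> / x + 2 * \<beta> * x"
    and cmp: "2 * \<beta> * x\<^sup>2 \<le> \<alpha>"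
    and qx: "-16 \<le> qx" "M / x \<le> exp_lower qx" "\<alpha> * qx \<le> \<alpha> * (M / x - 1) - \<beta> * (M - x)\<^sup>2"
    and q: "-16 \<le> q" "c * y * x ^ (n - 2) / D \<le> exp_lower q"
    and ends: "e \<le> (1 - \<alpha> / y) * Y - \<beta> * Y\<^sup>2" "e \<le> (1 - \<alpha> / y) * M - \<beta> * M\<^sup>2"
    and ends_r: "\<forall>z\<in>{ra, rb}. real n - 1 + \<alpha> * q \<le> 2 * \<alpha> + e + (real n - 2) * (\<alpha> + \<beta> * x\<^sup>2)
      + ((\<beta> * n - \<alpha> / c) * z - \<beta> * z\<^sup>2)"
  shows "real n - 1 + t \<le> (\<Sum>i<n. \<bar>lam i\<bar>)"
proof -
  let ?g = "\<lambda>i. \<bar>lam i\<bar> - \<alpha> * ln \<bar>lam i\<bar> - \<beta> * (lam i)\<^sup>2"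
  define cx where "cx = \<alpha> + \<beta> * x\<^sup>2 - \<alpha> * ln x"
  have n2: "2 \<le> n" using i1 i0 by auto
  have lnx: "ln (M / x) \<le> qx"
    using qx pos by (auto intro!: ln_le_of_le_exp_lower)
  have min: "cx \<le> ?g i" if "i < n" "i \<noteq> i0" for i
    using log_quadratic_min[of "\<bar>lam i\<bar>" M x \<alpha> \<beta> 1 qx] M[OF that] nonzero[OF that(1)] pos qx lnx cmp tangent
    by (simp add: cx_def)
  have "\<alpha> * ln \<bar>lam i1\<bar> \<le> \<alpha> * (ln y + \<bar>lam i1\<bar> / y - 1)"
    using ln_le_tangent[of y "\<bar>lam i1\<bar>"] pos nonzero[of i1] i1 by (intro mult_left_mono) auto
  moreover have "e \<le> (1 - \<alpha> / y) * \<bar>lam i1\<bar> - \<beta> * \<bar>lam i1\<bar>\<^sup>2"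
    using concave_quadratic_ge[OF i1(3) M[OF i1(1,2)] _ ends] pos by simp
  ultimately have big: "e + \<alpha> - \<alpha> * ln y \<le> ?g i1"
    by (simp add: algebra_simps)
  have "(real n - 2) * cx = (\<Sum>i\<in>{..<n} - {i0} - {i1}. cx)"
    using i0 i1 n2 by (simp add: of_nat_diff)
  also have "\<dots> \<le> (\<Sum>i\<in>{..<n} - {i0} - {i1}. ?g i)"
    using min by (intro sum_mono) auto
  finally have "(real n - 2) * cx + (e + \<alpha> - \<alpha> * ln y) \<le> (\<Sum>i\<in>{..<n} - {i0}. ?g i)"
    using big i1 i0 by (subst sum.remove[of _ i1]) auto
  then have G: "(real n - 2) * cx + (e + \<alpha> - \<alpha> * ln y)
      \<le> (\<Sum>i\<in>{..<n} - {i0}. \<bar>lam i\<bar> - 0 * lam i - \<alpha> * ln \<bar>lam i\<bar> - \<beta> * (lam i)\<^sup>2)"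
    by simp
  have "ln (c * y * x ^ (n - 2) / D) \<le> q"
    using q pos D by (intro ln_le_of_le_exp_lower) auto
  also have "ln (c * y * x ^ (n - 2) / D) = ln c + ln y + (real n - 2) * ln x - ln D"
    using pos D n2 by (simp add: ln_mult ln_div ln_realpow of_nat_diff)
  finally have lnq: "\<alpha> * (ln c + ln y + (real n - 2) * ln x - ln D) \<le> \<alpha> * q"
    using pos by (intro mult_left_mono) auto
  have lnr: "\<alpha> * ln r \<le> \<alpha> * (ln c + r / c - 1)"
    using ln_le_tangent[of c r] pos r_ge_1 by (intro mult_left_mono) auto
  define K where "K = (real n - 2) * (\<alpha> + \<beta> * x\<^sup>2) + 2 * \<alpha> + e - \<alpha> * q - (real n - 1)"
  have "- K \<le> (\<beta> * n - \<alpha> / c) * r - \<beta> * r\<^sup>2"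
    using ends_r pos by (intro concave_quadratic_ge[OF r]) (auto simp: K_def)
  then have "real n - 1 \<le> (\<beta> * n - 0) * r - \<alpha> * ln r - \<beta> * r\<^sup>2 + ((real n - 2) * cx + (e + \<alpha> - \<alpha> * ln y)) + \<alpha> * ln D"
    using lnr lnq by (simp add: K_def cx_def algebra_simps)
  then show ?thesis
    using energy_ge_of_others[OF _ pos(3) G] pos by simp
qed

text \<open>With \<open>\<gamma> = 0\<close> and all tangent points at \<open>1\<close> the certificate is exact for perfect matchings, where equality holds.\<close>

lemma energy_ge_small_radius:
  fixes M q :: real
  assumes n: "3 \<le> n" and M: "1 \<le> M" "r \<le> M" "2 / (n - 2) \<le> 1" "-16 \<le> q" "M \<le> exp_lower q"
    "(real n - 2) * q \<le> (M - 1) * (real n - 1 - M)"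
  shows "real n - 1 + t \<le> (\<Sum>i<n. \<bar>lam i\<bar>)"
proof -
  \<comment> \<open>\<open>\<alpha> + 2 \<beta> = 1\<close> puts the tangent point at 1, and
    \<open>\<beta> n = 1\<close> cancels \<open>t\<close>.\<close>
  define \<alpha> \<beta> where "\<alpha> = 1 - 2 / real n" and "\<beta> = 1 / real n"
  have ab: "0 < \<alpha>" "0 \<le> \<beta>" "\<beta> * n = 1" "\<alpha> + 2 * \<beta> = 1" "n * \<alpha> = real n - 2" "2 * \<beta> \<le> \<alpha>"
    using n M(3) by (auto simp: \<alpha>_def \<beta>_def field_simps of_nat_diff)
  have lnM: "ln (M / 1) \<le> q" using M by (auto intro!: ln_le_of_le_exp_lower)
  have "\<alpha> * q \<le> \<alpha> * (M / 1 - 1) - \<beta> * (M - 1)\<^sup>2"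
  proof -
    have "n * (\<alpha> * (M / 1 - 1) - \<beta> * (M - 1)\<^sup>2) = (n * \<alpha>) * (M - 1) - (\<beta> * n) * (M - 1)\<^sup>2"
      by (simp add: algebra_simps)
    also have "\<dots> = (M - 1) * (real n - 1 - M)"
      unfolding ab by (simp add: algebra_simps power2_eq_square)
    finally have "n * (\<alpha> * q) \<le> n * (\<alpha> * (M / 1 - 1) - \<beta> * (M - 1)\<^sup>2)"
      using M(6) ab(5) by (simp add: mult.assoc[symmetric])
    then show ?thesis using n by simp
  qed
  then have key: "\<alpha> + \<beta> \<le> x - \<alpha> * ln x - \<beta> * x\<^sup>2" if "0 < x" "x \<le> M" for x
    using log_quadratic_min[of x M 1 \<alpha> \<beta> 1 q] that ab M lnM by simp
  have "(\<Sum>i\<in>{..<n} - {i0}. \<alpha> + \<beta>) \<le> (\<Sum>i\<in>{..<n} - {i0}. \<bar>lam i\<bar> - 0 * lam i - \<alpha> * ln \<bar>lam i\<bar> - \<beta> * (lam i)\<^sup>2)"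
  proof (intro sum_mono)
    fix i assume "i \<in> {..<n} - {i0}"
    then show "\<alpha> + \<beta> \<le> \<bar>lam i\<bar> - 0 * lam i - \<alpha> * ln \<bar>lam i\<bar> - \<beta> * (lam i)\<^sup>2"
      using key[of "\<bar>lam i\<bar>"] abs_le[of i] M nonzero[of i] by simp
  qed
  then have G: "(real n - 1) * (\<alpha> + \<beta>) \<le> (\<Sum>i\<in>{..<n} - {i0}. \<bar>lam i\<bar> - 0 * lam i - \<alpha> * ln \<bar>lam i\<bar> - \<beta> * (lam i)\<^sup>2)"
    using i0 by (simp add: of_nat_diff)
  have "n * (\<alpha> + \<beta>) = real n - 1"
    using ab by (simp add: algebra_simps)
  moreover have "0 \<le> \<alpha> * ln D" using D ab by simp
  ultimately have "real n - 1 \<le> (\<beta> * n - 0) * r - \<alpha> * ln r - \<beta> * r\<^sup>2 + (real n - 1) * (\<alpha> + \<beta>) + \<alpha> * ln D"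
    using key[of r] r_ge_1 M ab by (simp add: algebra_simps)
  then show ?thesis
    using energy_ge_of_others[OF _ _ G] ab by simp
qed

text \<open>The constant \<open>7.11\<close> is chosen so that the tangent inequality with coefficient \<open>1 / 11\<close> still holds there.\<close>

lemma energy_ge_large_order:
  assumes n: "11 \<le> n" and r: "r \<le> 711 / 100"
  shows "real n - 1 + t \<le> (\<Sum>i<n. \<bar>lam i\<bar>)"
proof -
  \<comment> \<open>The bound must not exceed \<open>6.11 * 2.89 / 9\<close>, about 1.9620, while
    the logarithm is about 1.9615.\<close>
  have ln: "ln (711 / 100 / 1 :: real) \<le> 19617 / 10000"
    by (rule ln_le_of_le_exp_lower) (simp_all add: exp_lower_def power2_eq_square power3_eq_cube power_divide)
  have key: "10 / 11 \<le> x - 9 / 11 * ln x - 1 / 11 * x\<^sup>2" if "0 < x" "x \<le> 711 / 100" for x :: real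
    using log_quadratic_min[OF that, of 1 "9 / 11" "1 / 11" 1, OF _ _ _ _ _ _ ln]
    by (simp add: power2_eq_square)
  have "(\<Sum>i<n. 10 / 11) \<le> (\<Sum>i<n. \<bar>lam i\<bar> - 9 / 11 * ln \<bar>lam i\<bar> - 1 / 11 * (lam i)\<^sup>2)"
  proof (intro sum_mono)
    fix i assume "i \<in> {..<n}"
    then show "10 / 11 \<le> \<bar>lam i\<bar> - 9 / 11 * ln \<bar>lam i\<bar> - 1 / 11 * (lam i)\<^sup>2"
      using key[of "\<bar>lam i\<bar>"] abs_le[of i] r nonzero[of i] by simp
  qed
  also have "\<dots> = (\<Sum>i<n. \<bar>lam i\<bar>) - 9 / 11 * (\<Sum>i<n. ln \<bar>lam i\<bar>) - 1 / 11 * (n * t)"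
    unfolding sum_sq[symmetric] by (simp only: sum_subtractf sum_distrib_left)
  finally have le: "10 / 11 * n \<le> (\<Sum>i<n. \<bar>lam i\<bar>) - 9 / 11 * (\<Sum>i<n. ln \<bar>lam i\<bar>) - 1 / 11 * (n * t)"
    by simp
  have ln_nonneg: "0 \<le> (\<Sum>i<n. ln \<bar>lam i\<bar>)"
    using D nonzero by (subst ln_prod[symmetric]) auto
  \<comment> \<open>AM-GM for the squares yields \<open>t \<ge> 1\<close>. This is needed because
    the surplus that remains is \<open>(n / 11 - 1) (t - 1)\<close>.\<close>
  have "0 \<le> (\<Sum>i<n. 2 * ln \<bar>lam i\<bar>)"
    using ln_nonneg by (simp flip: sum_distrib_left)
  also have "\<dots> \<le> (\<Sum>i<n. (lam i)\<^sup>2 - 1)"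
  proof (intro sum_mono)
    fix i assume "i \<in> {..<n}"
    then show "2 * ln \<bar>lam i\<bar> \<le> (lam i)\<^sup>2 - 1"
      using ln_le_minus_one[of "\<bar>lam i\<bar>\<^sup>2"] ln_realpow[of "\<bar>lam i\<bar>" 2] nonzero[of i] by simp
  qed
  finally have "real n * 1 \<le> real n * t"
    by (simp add: sum_subtractf sum_sq)
  then have "1 \<le> t"
    using n by simp
  then have "11 * (t - 1) \<le> n * (t - 1)"
    using n by (intro mult_right_mono) auto
  then show ?thesis
    using le ln_nonneg by (simp add: algebra_simps)
qed

section \<open>Numerical certificates for orders 5 to 10\<close>

text \<open>The parameters come from numerical optimisation. The suffix \<open>_one\<close> or \<open>_two\<close> is the number of
  positive eigenvalues known besides \<open>r\<close>.\<close>

lemma energy_ge_order_5: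
  assumes "n = 5" "D = 2" "1 \<le> card {i. i < n \<and> i \<noteq> i0 \<and> 0 < lam i}"
  shows "real n - 1 + t \<le> (\<Sum>i<n. \<bar>lam i\<bar>)"
proof -
  have r_upper: "r \<le> 4"
    using r_le assms(1) by simp
  consider "r \<le> 63 / 20" | "63 / 20 \<le> r"
    by linarith
  then show ?thesis
  proof cases
    case 1
    \<comment> \<open>Here \<open>M\<close> is \<open>n / 2\<close>; in the second case it lies just
      above \<open>sqrt (n * ra - ra^2)\<close>.\<close>
    have M: "\<bar>lam i\<bar> \<le> 5 / 2" if "i < n" "i \<noteq> i0" for i
      by (rule abs_le_of_radius[OF that r_ge_1]) (simp_all add: assms power2_eq_square)
    show ?thesis
      by (rule energy_ge_certificate[OF assms(3) r_ge_1 1 M, where \<alpha> = "631 / 1300" and \<beta> = "13 / 80" and \<gamma> = "-693 / 5200"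
        and p = "1 / 2" and y = "4 / 5" and c = "9 / 5" and qp = "161 / 100" and qy = "57 / 50" and q = "-73 / 50"])
        (simp_all add: assms exp_lower_def power2_eq_square power3_eq_cube power_divide)
  next
    case 2
    have M: "\<bar>lam i\<bar> \<le> 121 / 50" if "i < n" "i \<noteq> i0" for i
      by (rule abs_le_of_radius[OF that 2]) (simp_all add: assms power2_eq_square)
    show ?thesis
      by (rule energy_ge_certificate[OF assms(3) 2 r_upper M, where \<alpha> = "987 / 3040" and \<beta> = "1 / 8" and \<gamma> = "-549 / 1520"
        and p = "1 / 4" and y = "7 / 10" and c = "7 / 2" and qp = "57 / 25" and qy = "5 / 4" and q = "-189 / 100"])
        (simp_all add: assms exp_lower_def power2_eq_square power3_eq_cube power_divide)
  qed
qed

lemma energy_ge_order_6_one: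
  assumes "n = 6" "D = 3" "1 \<le> card {i. i < n \<and> i \<noteq> i0 \<and> 0 < lam i}"
  shows "real n - 1 + t \<le> (\<Sum>i<n. \<bar>lam i\<bar>)"
proof -
  have r_upper: "r \<le> 5"
    using r_le assms(1) by simp
  consider "r \<le> 87 / 20" | "87 / 20 \<le> r"
    by linarith
  then show ?thesis
  proof cases
    case 1
    have M: "\<bar>lam i\<bar> \<le> 3" if "i < n" "i \<noteq> i0" for i
      by (rule abs_le_of_radius[OF that r_ge_1]) (simp_all add: assms power2_eq_square)
    show ?thesis
      by (rule energy_ge_certificate[OF assms(3) r_ge_1 1 M, where \<alpha> = "389 / 780" and \<beta> = "7 / 48" and \<gamma> = "-149 / 1040"
        and p = "1 / 2" and y = "4 / 5" and c = "21 / 10" and qp = "9 / 5" and qy = "133 / 100" and q = "-97 / 50"])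
        (simp_all add: assms exp_lower_def power2_eq_square power3_eq_cube power_divide)
  next
    case 2
    have M: "\<bar>lam i\<bar> \<le> 67 / 25" if "i < n" "i \<noteq> i0" for i
      by (rule abs_le_of_radius[OF that 2]) (simp_all add: assms power2_eq_square)
    show ?thesis
      by (rule energy_ge_certificate[OF assms(3) 2 r_upper M, where \<alpha> = "417 / 1120" and \<beta> = "1 / 8" and \<gamma> = "-177 / 560"
        and p = "3 / 10" and y = "3 / 4" and c = "5" and qp = "219 / 100" and qy = "32 / 25" and q = "-46 / 25"])
        (simp_all add: assms exp_lower_def power2_eq_square power3_eq_cube power_divide)
  qed
qed

lemma energy_ge_order_6_two:
  assumes "n = 6" "D = 1" "2 \<le> card {i. i < n \<and> i \<noteq> i0 \<and> 0 < lam i}"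
  shows "real n - 1 + t \<le> (\<Sum>i<n. \<bar>lam i\<bar>)"
proof -
  have r_upper: "r \<le> 5"
    using r_le assms(1) by simp
  consider "r \<le> 13 / 5" | "13 / 5 \<le> r" "r \<le> 73 / 20" | "73 / 20 \<le> r"
    by linarith
  then show ?thesis
  proof cases
    case 1
    show ?thesis
      by (rule energy_ge_small_radius[where M = "13 / 5" and q = "24 / 25"])
        (use 1 in \<open>simp_all add: assms exp_lower_def power2_eq_square power3_eq_cube power_divide\<close>)
  next
    case 2
    have M: "\<bar>lam i\<bar> \<le> 3" if "i < n" "i \<noteq> i0" for i
      by (rule abs_le_of_radius[OF that 2(1)]) (simp_all add: assms power2_eq_square)
    show ?thesis
      by (rule energy_ge_certificate[OF assms(3) 2(1) 2(2) M, where \<alpha> = "297 / 640" and \<beta> = "7 / 48" and \<gamma> = "-13 / 80"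
        and p = "9 / 20" and y = "3 / 4" and c = "37 / 10" and qp = "19 / 10" and qy = "139 / 100" and q = "-23 / 20"])
        (simp_all add: assms exp_lower_def power2_eq_square power3_eq_cube power_divide)
  next
    case 3
    have M: "\<bar>lam i\<bar> \<le> 293 / 100" if "i < n" "i \<noteq> i0" for i
      by (rule abs_le_of_radius[OF that 3]) (simp_all add: assms power2_eq_square)
    show ?thesis
      by (rule energy_ge_certificate[OF assms(3) 3 r_upper M, where \<alpha> = "2873 / 7360" and \<beta> = "5 / 48" and \<gamma> = "-803 / 2208"
        and p = "3 / 10" and y = "17 / 20" and c = "9 / 2" and qp = "57 / 25" and qy = "31 / 25" and q = "-139 / 100"])
        (simp_all add: assms exp_lower_def power2_eq_square power3_eq_cube power_divide)
  qed
qed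

lemma energy_ge_order_7:
  assumes "n = 7" "D = 2" "1 \<le> card {i. i < n \<and> i \<noteq> i0 \<and> 0 < lam i}"
  shows "real n - 1 + t \<le> (\<Sum>i<n. \<bar>lam i\<bar>)"
proof -
  have r_upper: "r \<le> 6"
    using r_le assms(1) by simp
  \<comment> \<open>Either some further eigenvalue is large and its own contribution suffices, or
    14/5 replaces the weaker bound 84/25 and the tangent inequalities have to hold on a shorter
    range only.\<close>
  consider "r \<le> 453 / 100" | "453 / 100 \<le> r" "\<exists>i<n. i \<noteq> i0 \<and> 14 / 5 \<le> \<bar>lam i\<bar>"
    | "453 / 100 \<le> r" "\<And>i. i < n \<Longrightarrow> i \<noteq> i0 \<Longrightarrow> \<bar>lam i\<bar> \<le> 14 / 5"
    by (meson linear)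
  then show ?thesis
  proof cases
    case 1
    have M: "\<bar>lam i\<bar> \<le> 7 / 2" if "i < n" "i \<noteq> i0" for i
      by (rule abs_le_of_radius[OF that r_ge_1]) (simp_all add: assms power2_eq_square)
    show ?thesis
      by (rule energy_ge_certificate[OF assms(3) r_ge_1 1 M, where \<alpha> = "1853 / 3100" and \<beta> = "1 / 7" and \<gamma> = "-117 / 2170"
        and p = "7 / 10" and y = "17 / 20" and c = "23 / 10" and qp = "161 / 100" and qy = "71 / 50" and q = "-51 / 50"])
        (simp_all add: assms exp_lower_def power2_eq_square power3_eq_cube power_divide)
  next
    case 2
    then obtain i1 where i1: "i1 < n" "i1 \<noteq> i0" "14 / 5 \<le> \<bar>lam i1\<bar>"
      by blast
    have M: "\<bar>lam i\<bar> \<le> 84 / 25" if "i < n" "i \<noteq> i0" for i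
      by (rule abs_le_of_radius[OF that 2(1)]) (simp_all add: assms power2_eq_square)
    show ?thesis
      by (rule energy_ge_certificate_large[OF i1 2(1) r_upper M, where \<alpha> = "13 / 20" and \<beta> = "0"
        and x = "13 / 20" and y = "3" and c = "26 / 5" and qx = "33 / 20" and q = "-9 / 100" and e = "329 / 150"])
        (simp_all add: assms exp_lower_def power2_eq_square power3_eq_cube power_divide)
  next
    case 3
    show ?thesis
    proof (cases "r \<le> 549 / 100")
      case True
      show ?thesis
        by (rule energy_ge_certificate[OF assms(3) 3(1) True 3(2), where \<alpha> = "124209 / 313600" and \<beta> = "23 / 224" and \<gamma> = "-2395 / 6272"
          and p = "3 / 10" and y = "37 / 40" and c = "27 / 5" and qp = "56 / 25" and qy = "111 / 100" and q = "-3 / 5"])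
          (simp_all add: assms exp_lower_def power2_eq_square power3_eq_cube power_divide)
    next
      case False
      then have r: "549 / 100 \<le> r" by simp
      show ?thesis
        by (rule energy_ge_certificate[OF assms(3) r r_upper 3(2), where \<alpha> = "1346319 / 4121600" and \<beta> = "19 / 224" and \<gamma> = "-1803 / 3680"
          and p = "9 / 40" and y = "37 / 40" and c = "28 / 5" and qp = "253 / 100" and qy = "111 / 100" and q = "-17 / 20"])
          (simp_all add: assms exp_lower_def power2_eq_square power3_eq_cube power_divide)
    qed
  qed
qed

lemma energy_ge_order_8_one:
  assumes "n = 8" "D = 3" "1 \<le> card {i. i < n \<and> i \<noteq> i0 \<and> 0 < lam i}"
  shows "real n - 1 + t \<le> (\<Sum>i<n. \<bar>lam i\<bar>)"
proof -
  have r_upper: "r \<le> 7"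
    using r_le assms(1) by simp
  consider "r \<le> 289 / 50" | "289 / 50 \<le> r"
    by linarith
  then show ?thesis
  proof cases
    case 1
    have M: "\<bar>lam i\<bar> \<le> 4" if "i < n" "i \<noteq> i0" for i
      by (rule abs_le_of_radius[OF that r_ge_1]) (simp_all add: assms power2_eq_square)
    show ?thesis
      by (rule energy_ge_certificate[OF assms(3) r_ge_1 1 M, where \<alpha> = "2873 / 4800" and \<beta> = "1 / 8" and \<gamma> = "-1 / 12"
        and p = "13 / 20" and y = "17 / 20" and c = "13 / 5" and qp = "91 / 50" and qy = "31 / 20" and q = "-77 / 50"])
        (simp_all add: assms exp_lower_def power2_eq_square power3_eq_cube power_divide)
  next
    case 2
    have M: "\<bar>lam i\<bar> \<le> 359 / 100" if "i < n" "i \<noteq> i0" for i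
      by (rule abs_le_of_radius[OF that 2]) (simp_all add: assms power2_eq_square)
    show ?thesis
      by (rule energy_ge_certificate[OF assms(3) 2 r_upper M, where \<alpha> = "2329 / 6720" and \<beta> = "11 / 128" and \<gamma> = "-11539 / 26880"
        and p = "1 / 4" and y = "4 / 5" and c = "69 / 10" and qp = "267 / 100" and qy = "151 / 100" and q = "-189 / 100"])
        (simp_all add: assms exp_lower_def power2_eq_square power3_eq_cube power_divide)
  qed
qed

lemma energy_ge_order_8_two:
  assumes "n = 8" "D = 1" "2 \<le> card {i. i < n \<and> i \<noteq> i0 \<and> 0 < lam i}"
  shows "real n - 1 + t \<le> (\<Sum>i<n. \<bar>lam i\<bar>)"
proof -
  have r_upper: "r \<le> 7"
    using r_le assms(1) by simp
  consider "r \<le> 21 / 5" | "21 / 5 \<le> r" "r \<le> 287 / 50" | "287 / 50 \<le> r"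
    by linarith
  then show ?thesis
  proof cases
    case 1
    show ?thesis
      by (rule energy_ge_small_radius[where M = "21 / 5" and q = "36 / 25"])
        (use 1 in \<open>simp_all add: assms exp_lower_def power2_eq_square power3_eq_cube power_divide\<close>)
  next
    case 2
    have M: "\<bar>lam i\<bar> \<le> 4" if "i < n" "i \<noteq> i0" for i
      by (rule abs_le_of_radius[OF that 2(1)]) (simp_all add: assms power2_eq_square)
    show ?thesis
      by (rule energy_ge_certificate[OF assms(3) 2(1) 2(2) M, where \<alpha> = "7599 / 16000" and \<beta> = "13 / 128" and \<gamma> = "-1719 / 6400"
        and p = "2 / 5" and y = "17 / 20" and c = "59 / 10" and qp = "231 / 100" and qy = "31 / 20" and q = "-87 / 100"])
        (simp_all add: assms exp_lower_def power2_eq_square power3_eq_cube power_divide)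
  next
    case 3
    have M: "\<bar>lam i\<bar> \<le> 361 / 100" if "i < n" "i \<noteq> i0" for i
      by (rule abs_le_of_radius[OF that 3]) (simp_all add: assms power2_eq_square)
    show ?thesis
      by (rule energy_ge_certificate[OF assms(3) 3 r_upper M, where \<alpha> = "1989 / 5632" and \<beta> = "5 / 64" and \<gamma> = "-159 / 352"
        and p = "1 / 4" and y = "17 / 20" and c = "59 / 10" and qp = "67 / 25" and qy = "29 / 20" and q = "-181 / 100"])
        (simp_all add: assms exp_lower_def power2_eq_square power3_eq_cube power_divide)
  qed
qed

text \<open>From this order on \<open>n - 1\<close> exceeds 7.11, so the hypothesis on the radius
  takes over from \<open>r_le\<close>.\<close>

lemma energy_ge_order_9:
  assumes "n = 9" "D = 2" "1 \<le> card {i. i < n \<and> i \<noteq> i0 \<and> 0 < lam i}"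
    and r_le_711: "r \<le> 711 / 100"
  shows "real n - 1 + t \<le> (\<Sum>i<n. \<bar>lam i\<bar>)"
proof -
  have r_upper: "r \<le> 711 / 100"
    using r_le_711 by simp
  consider "r \<le> 587 / 100" | "587 / 100 \<le> r" "r \<le> 347 / 50" | "347 / 50 \<le> r"
    by linarith
  then show ?thesis
  proof cases
    case 1
    have M: "\<bar>lam i\<bar> \<le> 9 / 2" if "i < n" "i \<noteq> i0" for i
      by (rule abs_le_of_radius[OF that r_ge_1]) (simp_all add: assms power2_eq_square)
    show ?thesis
      by (rule energy_ge_certificate[OF assms(3) r_ge_1 1 M, where \<alpha> = "298 / 465" and \<beta> = "1 / 9" and \<gamma> = "-59 / 2790"
        and p = "3 / 4" and y = "4 / 5" and c = "5 / 2" and qp = "9 / 5" and qy = "173 / 100" and q = "-81 / 50"])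
        (simp_all add: assms exp_lower_def power2_eq_square power3_eq_cube power_divide)
  next
    case 2
    have M: "\<bar>lam i\<bar> \<le> 429 / 100" if "i < n" "i \<noteq> i0" for i
      by (rule abs_le_of_radius[OF that 2(1)]) (simp_all add: assms power2_eq_square)
    show ?thesis
      by (rule energy_ge_certificate[OF assms(3) 2(1) 2(2) M, where \<alpha> = "123 / 224" and \<beta> = "5 / 48" and \<gamma> = "-17 / 84"
        and p = "1 / 2" and y = "9 / 10" and c = "69 / 10" and qp = "43 / 20" and qy = "157 / 100" and q = "-19 / 100"])
        (simp_all add: assms exp_lower_def power2_eq_square power3_eq_cube power_divide)
  next
    case 3
    have M: "\<bar>lam i\<bar> \<le> 379 / 100" if "i < n" "i \<noteq> i0" for i
      by (rule abs_le_of_radius[OF that 3]) (simp_all add: assms power2_eq_square)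
    show ?thesis
      by (rule energy_ge_certificate[OF assms(3) 3 r_upper M, where \<alpha> = "104 / 225" and \<beta> = "1 / 9" and \<gamma> = "-11 / 45"
        and p = "2 / 5" and y = "4 / 5" and c = "69 / 10" and qp = "9 / 4" and qy = "39 / 25" and q = "-1239 / 1000"])
        (simp_all add: assms exp_lower_def power2_eq_square power3_eq_cube power_divide)
  qed
qed

lemma energy_ge_order_10:
  assumes "n = 10" "D = 1" "1 \<le> card {i. i < n \<and> i \<noteq> i0 \<and> 0 < lam i}"
    and r_le_711: "r \<le> 711 / 100"
  shows "real n - 1 + t \<le> (\<Sum>i<n. \<bar>lam i\<bar>)"
proof -
  have r_upper: "r \<le> 711 / 100"
    using r_le_711 by simp
  consider "r \<le> 59 / 10" | "59 / 10 \<le> r" "\<exists>i<n. i \<noteq> i0 \<and> 3 \<le> \<bar>lam i\<bar>"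
    | "59 / 10 \<le> r" "\<And>i. i < n \<Longrightarrow> i \<noteq> i0 \<Longrightarrow> \<bar>lam i\<bar> \<le> 3"
    by (meson linear)
  then show ?thesis
  proof cases
    case 1
    show ?thesis
      by (rule energy_ge_small_radius[where M = "59 / 10" and q = "89 / 50"])
        (use 1 in \<open>simp_all add: assms exp_lower_def power2_eq_square power3_eq_cube power_divide\<close>)
  next
    case 2
    then obtain i1 where i1: "i1 < n" "i1 \<noteq> i0" "3 \<le> \<bar>lam i1\<bar>"
      by blast
    have M: "\<bar>lam i\<bar> \<le> 5" if "i < n" "i \<noteq> i0" for i
      by (rule abs_le_of_radius[OF that 2(1)]) (simp_all add: assms power2_eq_square)
    show ?thesis
      by (rule energy_ge_certificate_large[OF i1 2(1) r_upper M, where \<alpha> = "1131 / 2000" and \<beta> = "1 / 10"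
        and x = "13 / 20" and y = "39 / 10" and c = "13 / 2" and qx = "41 / 20" and q = "-21 / 100" and e = "333 / 200"])
        (simp_all add: assms exp_lower_def power2_eq_square power3_eq_cube power_divide)
  next
    case 3
    show ?thesis
      by (rule energy_ge_certificate[OF assms(3) 3(1) r_upper 3(2), where \<alpha> = "1001 / 2400" and \<beta> = "1 / 10" and \<gamma> = "-209 / 600"
        and p = "13 / 40" and y = "7 / 8" and c = "69 / 10" and qp = "223 / 100" and qy = "31 / 25" and q = "-13 / 50"])
        (simp_all add: assms exp_lower_def power2_eq_square power3_eq_cube power_divide)
  qed
qed

end

section \<open>Orthonormal eigenbases of real symmetric matrices\<close>

text \<open>Over the complex numbers an eigenvector \<open>v\<close> exists. The Hermitian form of
  \<open>A\<close> at \<open>v\<close> is real by symmetry and equals \<open>a\<close> times the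
  squared norm of \<open>v\<close>, so \<open>a\<close> is real.\<close>

lemma real_symmetric_eigenvalue:
  fixes A :: "real mat"
  assumes A: "A \<in> carrier_mat n n" and sym: "transpose_mat A = A" and n: "0 < n"
  shows "\<exists>e. eigenvalue A e"
proof -
  let ?C = "map_mat complex_of_real A"
  have C: "?C \<in> carrier_mat n n" using A by simp
  obtain as where as: "char_poly ?C = (\<Prod>a\<leftarrow>as. [:- a, 1:])" "length as = n"
    using char_poly_factorized[OF C] by blast
  then obtain a bs where "as = a # bs" using n by (cases as) auto
  then have root: "poly (char_poly ?C) a = 0" using as by simp
  then have "eigenvalue ?C a" using eigenvalue_root_char_poly[OF C] by simp
  then obtain v where v: "v \<in> carrier_vec n" "v \<noteq> 0\<^sub>v n" "?C *\<^sub>v v = a \<cdot>\<^sub>v v"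
    using C unfolding eigenvalue_def eigenvector_def by auto
  have row: "(\<Sum>j<n. of_real (A $$ (i, j)) * v $ j) = a * v $ i" if "i < n" for i
  proof -
    have "(?C *\<^sub>v v) $ i = (\<Sum>j<n. of_real (A $$ (i, j)) * v $ j)"
      using that A v(1) by (simp add: scalar_prod_def atLeast0LessThan)
    then show ?thesis using v that by simp
  qed
  have A_sym: "A $$ (i, j) = A $$ (j, i)" if "i < n" "j < n" for i j
    using arg_cong[OF sym, of "\<lambda>B. B $$ (i, j)"] that A by simp
  define s where "s = (\<Sum>i<n. \<Sum>j<n. cnj (v $ i) * (of_real (A $$ (i, j)) * v $ j))"
  have s_eq: "s = a * (\<Sum>i<n. v $ i * cnj (v $ i))"
    unfolding s_def sum_distrib_left[symmetric] using row
    by (simp add: sum_distrib_left mult_ac)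
  have "cnj s = (\<Sum>i<n. \<Sum>j<n. v $ i * (of_real (A $$ (i, j)) * cnj (v $ j)))"
    by (simp add: s_def)
  also have "\<dots> = (\<Sum>j<n. \<Sum>i<n. v $ i * (of_real (A $$ (i, j)) * cnj (v $ j)))"
    by (rule sum.swap)
  also have "\<dots> = s"
    unfolding s_def by (intro sum.cong refl) (simp add: A_sym mult_ac)
  finally have s_real: "cnj s = s" .
  define N where "N = (\<Sum>i<n. (cmod (v $ i))\<^sup>2)"
  have norm: "(\<Sum>i<n. v $ i * cnj (v $ i)) = of_real N"
    unfolding N_def of_real_sum complex_norm_square ..
  have "N \<noteq> 0"
  proof
    assume "N = 0"
    then have "\<forall>i<n. v $ i = 0"
      unfolding N_def by (subst (asm) sum_nonneg_eq_0_iff) auto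
    then have "v = 0\<^sub>v n" using v(1) by (intro eq_vecI) auto
    with v(2) show False by simp
  qed
  then have "cnj a = a"
    using s_real unfolding s_eq norm by simp
  then have a: "a = of_real (Re a)"
    by (simp add: complex_eq_iff)
  have "poly (char_poly ?C) (of_real (Re a)) = of_real (poly (char_poly A) (Re a))"
    unfolding of_real_hom.char_poly_hom[OF A] by simp
  then have "poly (char_poly A) (Re a) = 0"
    using root a by simp
  then show ?thesis
    using eigenvalue_root_char_poly[OF A] by blast
qed

text \<open>The reflection exchanging the first unit vector with a given unit vector. If the two agree, then
  division by \<open>0\<close> makes it the identity.\<close>

definition householder :: "nat \<Rightarrow> real vec \<Rightarrow> real mat" where
  "householder n v = (let w = (\<lambda>i. (if i = 0 then 1 else 0) - v $ i); s = (\<Sum>i<n. (w i)\<^sup>2)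
    in mat n n (\<lambda>(i, j). (if i = j then 1 else 0) - 2 * w i * w j / s))"

lemma householder_carrier [simp]: "householder n v \<in> carrier_mat n n"
  by (simp add: householder_def Let_def)

lemma householder_symmetric: "transpose_mat (householder n v) = householder n v"
  by (intro eq_matI) (auto simp: householder_def Let_def)

lemma householder_involution: "householder n v * householder n v = 1\<^sub>m n"
proof -
  define w where "w i = (if i = 0 then 1 else 0) - v $ i" for i
  define s where "s = (\<Sum>i<n. (w i)\<^sup>2)"
  have H: "householder n v = mat n n (\<lambda>(i, j). (if i = j then 1 else 0) - 2 * w i * w j / s)"
    by (simp add: householder_def w_def s_def)
  have "(\<Sum>k<n. ((if i = k then 1 else 0) - 2 * w i * w k / s) * ((if k = j then 1 else 0) - 2 * w k * w j / s))
      = (if i = j then 1 else 0)" if "i < n" "j < n" for i j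
  proof -
    have "(\<Sum>k<n. ((if i = k then 1 else 0) - 2 * w i * w k / s) * ((if k = j then 1 else 0) - 2 * w k * w j / s))
      = (\<Sum>k<n. (if i = k then (if k = j then 1 else 0) else 0) - (if i = k then 2 * w k * w j / s else 0)
          - (if k = j then 2 * w i * w k / s else 0) + 4 * w i * w j / s\<^sup>2 * (w k)\<^sup>2)"
      by (intro sum.cong refl) (simp add: algebra_simps power2_eq_square)
    also have "\<dots> = (if i = j then 1 else 0) - 2 * w i * w j / s - 2 * w i * w j / s + 4 * w i * w j / s\<^sup>2 * (\<Sum>k<n. (w k)\<^sup>2)"
      using that by (simp add: sum.distrib sum_subtractf sum_distrib_left)
    also have "\<dots> = (if i = j then 1 else 0)"
      unfolding s_def[symmetric] by (cases "s = 0") (auto simp: field_simps power2_eq_square)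
    finally show ?thesis .
  qed
  then show ?thesis
    unfolding H by (intro eq_matI) (auto simp: scalar_prod_def atLeast0LessThan)
qed

text \<open>For a unit vector \<open>v\<close> the squared norm of \<open>w\<close> is
  \<open>2 * w 0\<close>, so the reflection subtracts exactly \<open>w\<close> from the first unit
  vector.\<close>

lemma col_householder:
  assumes v: "v \<in> carrier_vec n" "(\<Sum>i<n. (v $ i)\<^sup>2) = 1" and n: "0 < n"
  shows "col (householder n v) 0 = v"
proof -
  define w where "w i = (if i = 0 then 1 else 0) - v $ i" for i
  define s where "s = (\<Sum>i<n. (w i)\<^sup>2)"
  have H: "householder n v = mat n n (\<lambda>(i, j). (if i = j then 1 else 0) - 2 * w i * w j / s)"
    by (simp add: householder_def w_def s_def)
  have "s = (\<Sum>i<n. (if i = 0 then 1 - 2 * v $ i else 0) + (v $ i)\<^sup>2)"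
    unfolding s_def w_def by (intro sum.cong refl) (simp add: power2_eq_square algebra_simps)
  also have "\<dots> = 2 * (1 - v $ 0)"
    using n v(2) by (simp add: sum.distrib)
  finally have s: "s = 2 * w 0" by (simp add: w_def)
  have "(if i = 0 then 1 else 0) - 2 * w i * w 0 / s = v $ i" if "i < n" for i
  proof (cases "s = 0")
    case True
    then have "\<forall>i<n. w i = 0"
      unfolding s_def by (subst (asm) sum_nonneg_eq_0_iff) auto
    then show ?thesis using that True by (simp add: w_def)
  next
    case False
    then have "2 * w i * w 0 / s = w i" using s by simp
    then show ?thesis by (simp add: w_def)
  qed
  then show ?thesis
    unfolding H using v(1) n by (intro eq_vecI) auto
qed

text \<open>Conjugation by a reflection whose first column is a unit eigenvector makes the first
  unit vector an eigenvector; by symmetry the first row is cleared as well, and the induction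
  hypothesis diagonalises the remaining block.\<close>

lemma real_spectral_matrix:
  fixes A :: "real mat"
  assumes "A \<in> carrier_mat n n" and "transpose_mat A = A"
  shows "\<exists>Q d. Q \<in> carrier_mat n n \<and> transpose_mat Q * Q = 1\<^sub>m n \<and> transpose_mat Q * A * Q = mat_diag n d"
  using assms
proof (induction n arbitrary: A)
  case 0
  then show ?case
    by (intro exI[of _ "1\<^sub>m 0"] exI[of _ "\<lambda>_. 0"]) (auto simp: mat_diag_def intro!: eq_matI)
next
  case (Suc n)
  note A = Suc.prems(1) and sym = Suc.prems(2)
  obtain e x where x: "x \<in> carrier_vec (Suc n)" "x \<noteq> 0\<^sub>v (Suc n)" "A *\<^sub>v x = e \<cdot>\<^sub>v x"
    using real_symmetric_eigenvalue[OF A sym] A unfolding eigenvalue_def eigenvector_def by auto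
  define s where "s = (\<Sum>i<Suc n. (x $ i)\<^sup>2)"
  have "s \<noteq> 0"
  proof
    assume "s = 0"
    then have "\<forall>i<Suc n. x $ i = 0"
      unfolding s_def by (subst (asm) sum_nonneg_eq_0_iff) auto
    then have "x = 0\<^sub>v (Suc n)" using x(1) by (intro eq_vecI) auto
    with x(2) show False by simp
  qed
  moreover have "0 \<le> s" unfolding s_def by (intro sum_nonneg) auto
  ultimately have s: "0 < s" by simp
  define v where "v = (1 / sqrt s) \<cdot>\<^sub>v x"
  have v: "v \<in> carrier_vec (Suc n)" using x by (simp add: v_def)
  have v_unit: "(\<Sum>i<Suc n. (v $ i)\<^sup>2) = 1"
  proof -
    have "(\<Sum>i<Suc n. (v $ i)\<^sup>2) = (\<Sum>i<Suc n. (x $ i)\<^sup>2 / s)"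
      using x(1) s by (intro sum.cong refl) (simp add: v_def power_divide)
    also have "\<dots> = 1" using s unfolding sum_divide_distrib[symmetric] by (simp add: s_def)
    finally show ?thesis .
  qed
  have Av: "A *\<^sub>v v = e \<cdot>\<^sub>v v"
    using x A by (simp add: v_def mult_mat_vec smult_smult_assoc mult.commute)
  let ?W = "householder (Suc n) v"
  have W: "?W \<in> carrier_mat (Suc n) (Suc n)" "transpose_mat ?W = ?W" "?W * ?W = 1\<^sub>m (Suc n)"
    by (simp_all add: householder_symmetric householder_involution)
  define B where "B = ?W * A * ?W"
  have B: "B \<in> carrier_mat (Suc n) (Suc n)" unfolding B_def using A W(1) by (intro mult_carrier_mat)
  have B_sym: "transpose_mat B = B"
    unfolding B_def transpose_mult[OF mult_carrier_mat[OF W(1) A] W(1)] transpose_mult[OF W(1) A] W(2) sym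
    by (rule assoc_mult_mat[OF W(1) A W(1), symmetric])
  have col_W: "col ?W 0 = v" by (rule col_householder[OF v v_unit]) simp
  have "col B 0 = (?W * A) *\<^sub>v v"
    unfolding B_def using col_mult2[OF mult_carrier_mat[OF W(1) A] W(1), of 0] col_W by simp
  also have "\<dots> = e \<cdot>\<^sub>v (?W *\<^sub>v v)"
    using mult_mat_vec[OF W(1) v, of e] by (simp add: assoc_mult_mat_vec[OF W(1) A v] Av)
  also have "?W *\<^sub>v v = col (?W * ?W) 0"
    using col_mult2[OF W(1) W(1), of 0] col_W by simp
  finally have col_B: "col B 0 = e \<cdot>\<^sub>v col (1\<^sub>m (Suc n)) 0" unfolding W(3) .
  have B0: "B $$ (i, 0) = (if i = 0 then e else 0)" if "i < Suc n" for i
    using arg_cong[OF col_B, of "\<lambda>u. u $ i"] B that by auto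
  have B_comm: "B $$ (i, j) = B $$ (j, i)" if "i < Suc n" "j < Suc n" for i j
    using arg_cong[OF B_sym, of "\<lambda>M. M $$ (i, j)"] B that by simp
  define A' where "A' = mat n n (\<lambda>(i, j). B $$ (Suc i, Suc j))"
  have A': "A' \<in> carrier_mat n n" "transpose_mat A' = A'"
    using B_comm by (auto simp: A'_def intro!: eq_matI)
  obtain Q' d' where Q': "Q' \<in> carrier_mat n n" "transpose_mat Q' * Q' = 1\<^sub>m n"
      "transpose_mat Q' * A' * Q' = mat_diag n d'"
    using Suc.IH[OF A'] by blast
  have B_block: "B = four_block_mat (mat 1 1 (\<lambda>_. e)) (0\<^sub>m 1 n) (0\<^sub>m n 1) A'"
  proof (rule eq_matI)
    fix i j assume "i < dim_row (four_block_mat (mat 1 1 (\<lambda>_. e)) (0\<^sub>m 1 n) (0\<^sub>m n 1) A')"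
      "j < dim_col (four_block_mat (mat 1 1 (\<lambda>_. e)) (0\<^sub>m 1 n) (0\<^sub>m n 1) A')"
    then show "B $$ (i, j) = four_block_mat (mat 1 1 (\<lambda>_. e)) (0\<^sub>m 1 n) (0\<^sub>m n 1) A' $$ (i, j)"
      using B0 B_comm[of i 0] B_comm[of 0 j] by (cases i; cases j) (auto simp: A'_def)
  qed (use B in \<open>auto simp: A'_def\<close>)
  define R where "R = four_block_mat (1\<^sub>m 1) (0\<^sub>m 1 n) (0\<^sub>m n 1) Q'"
  have R: "R \<in> carrier_mat (Suc n) (Suc n)"
    unfolding R_def using four_block_carrier_mat[of "1\<^sub>m 1" 1 1 Q' n n] Q'(1) by simp
  have R_t: "transpose_mat R = four_block_mat (1\<^sub>m 1) (0\<^sub>m 1 n) (0\<^sub>m n 1) (transpose_mat Q')"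
    unfolding R_def using Q'(1) by (subst transpose_four_block_mat) auto
  have RR: "transpose_mat R * R = 1\<^sub>m (Suc n)"
    unfolding R_t unfolding R_def using Q'
    by (subst mult_four_block_mat[of _ 1 1 _ n _ n _ _ 1 _ n]) (auto intro!: eq_matI)
  have RBR: "transpose_mat R * B * R = mat_diag (Suc n) (case_nat e d')"
  proof -
    have "transpose_mat R * B = four_block_mat (mat 1 1 (\<lambda>_. e)) (0\<^sub>m 1 n) (0\<^sub>m n 1) (transpose_mat Q' * A')"
      unfolding R_t B_block using Q'(1) A'(1)
      by (subst mult_four_block_mat[of _ 1 1 _ n _ n _ _ 1 _ n]) auto
    also have "\<dots> * R = four_block_mat (mat 1 1 (\<lambda>_. e)) (0\<^sub>m 1 n) (0\<^sub>m n 1) (mat_diag n d')"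
      unfolding R_def using Q' A'(1)
      by (subst mult_four_block_mat[of _ 1 1 _ n _ n _ _ 1 _ n]) auto
    also have "\<dots> = mat_diag (Suc n) (case_nat e d')"
      by (rule eq_matI) (auto simp: mat_diag_def split: nat.split)
    finally show ?thesis .
  qed
  define Q where "Q = ?W * R"
  have Q: "Q \<in> carrier_mat (Suc n) (Suc n)" unfolding Q_def by (rule mult_carrier_mat[OF W(1) R])
  have Rt: "transpose_mat R \<in> carrier_mat (Suc n) (Suc n)" using R by simp
  have Q_t: "transpose_mat Q = transpose_mat R * ?W"
    unfolding Q_def transpose_mult[OF W(1) R] W(2) ..
  note carr = W(1) A R Rt mult_carrier_mat[OF Rt W(1)] mult_carrier_mat[OF W(1) A] mult_carrier_mat[OF W(1) W(1)]
    mult_carrier_mat[OF W(1) R]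
  have "transpose_mat Q * Q = transpose_mat R * (?W * (?W * R))"
    unfolding Q_t unfolding Q_def by (rule assoc_mult_mat[OF Rt W(1) carr(8)])
  also have "?W * (?W * R) = R"
    using R by (simp add: assoc_mult_mat[OF W(1) W(1) R, symmetric] W(3))
  finally have QQ: "transpose_mat Q * Q = 1\<^sub>m (Suc n)" using RR by simp
  have "transpose_mat Q * A * Q = transpose_mat R * (?W * A) * (?W * R)"
    unfolding Q_t unfolding Q_def by (simp add: assoc_mult_mat[OF Rt W(1) A])
  also have "\<dots> = transpose_mat R * (?W * A) * ?W * R"
    by (rule assoc_mult_mat[OF mult_carrier_mat[OF Rt carr(6)] W(1) R, symmetric])
  also have "transpose_mat R * (?W * A) * ?W = transpose_mat R * B"
    unfolding B_def by (rule assoc_mult_mat[OF Rt carr(6) W(1)])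
  finally have "transpose_mat Q * A * Q = transpose_mat R * B * R" .
  then show ?case using Q QQ RBR by auto
qed

lemma prod_list_map_upt: "prod_list (map f [0..<n]) = (\<Prod>i<n. f i :: 'a :: comm_monoid_mult)"
  by (induction n) (simp_all add: mult.commute)

section \<open>Trace, form and determinant in an orthonormal eigenbasis\<close>

text \<open>\<open>u i j\<close> is coordinate \<open>j\<close> of the eigenvector for
  \<open>d i\<close>. With plain functions in place of matrices, vertices can be relabelled and the
  form evaluated at any vector by manipulating sums.\<close>

locale eigenbasis =
  fixes n :: nat and a u :: "nat \<Rightarrow> nat \<Rightarrow> real" and d :: "nat \<Rightarrow> real"
  assumes orthonormal: "\<And>i k. i < n \<Longrightarrow> k < n \<Longrightarrow> (\<Sum>j<n. u i j * u k j) = (if i = k then 1 else 0)"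
    and complete: "\<And>j k. j < n \<Longrightarrow> k < n \<Longrightarrow> (\<Sum>i<n. u i j * u i k) = (if j = k then 1 else 0)"
    and decomp: "\<And>j k. j < n \<Longrightarrow> k < n \<Longrightarrow> a j k = (\<Sum>i<n. d i * u i j * u i k)"
begin

lemma eigenvector: "i < n \<Longrightarrow> j < n \<Longrightarrow> (\<Sum>k<n. a j k * u i k) = d i * u i j"
proof -
  assume i: "i < n" and j: "j < n"
  have "(\<Sum>k<n. a j k * u i k) = (\<Sum>k<n. \<Sum>l<n. d l * u l j * (u l k * u i k))"
    using j by (intro sum.cong refl) (simp add: decomp sum_distrib_left sum_distrib_right mult_ac)
  also have "\<dots> = (\<Sum>l<n. d l * u l j * (\<Sum>k<n. u l k * u i k))"
    by (subst sum.swap) (simp add: sum_distrib_left)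
  also have "\<dots> = (\<Sum>l<n. if l = i then d l * u l j else 0)"
    using i by (intro sum.cong refl) (simp add: orthonormal)
  finally show ?thesis using i by simp
qed

lemma trace: "(\<Sum>j<n. a j j) = (\<Sum>i<n. d i)"
proof -
  have "(\<Sum>j<n. a j j) = (\<Sum>j<n. \<Sum>i<n. d i * (u i j * u i j))"
    by (intro sum.cong refl) (simp add: decomp mult_ac)
  also have "\<dots> = (\<Sum>i<n. d i * (\<Sum>j<n. u i j * u i j))"
    by (subst sum.swap) (simp add: sum_distrib_left)
  finally show ?thesis by (simp add: orthonormal)
qed

lemma sum_squares: "(\<Sum>j<n. \<Sum>k<n. (a j k)\<^sup>2) = (\<Sum>i<n. (d i)\<^sup>2)"
proof -
  have "(\<Sum>j<n. \<Sum>k<n. (a j k)\<^sup>2) = (\<Sum>j<n. \<Sum>k<n. \<Sum>i<n. a j k * (d i * u i j * u i k))"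
    unfolding sum_distrib_left[symmetric] by (intro sum.cong refl) (simp add: decomp[symmetric] power2_eq_square)
  also have "\<dots> = (\<Sum>j<n. \<Sum>i<n. \<Sum>k<n. a j k * (d i * u i j * u i k))"
    by (rule sum.cong[OF refl]) (rule sum.swap)
  also have "\<dots> = (\<Sum>j<n. \<Sum>i<n. d i * u i j * (\<Sum>k<n. a j k * u i k))"
    by (simp add: sum_distrib_left mult_ac)
  also have "\<dots> = (\<Sum>j<n. \<Sum>i<n. (d i)\<^sup>2 * (u i j * u i j))"
    by (intro sum.cong refl) (simp add: eigenvector power2_eq_square mult_ac)
  also have "\<dots> = (\<Sum>i<n. (d i)\<^sup>2 * (\<Sum>j<n. u i j * u i j))"
    by (subst sum.swap) (simp add: sum_distrib_left)
  finally show ?thesis by (simp add: orthonormal)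
qed

lemma quadratic_form:
  "(\<Sum>j<n. \<Sum>k<n. a j k * x j * x k) = (\<Sum>i<n. d i * (\<Sum>j<n. u i j * x j)\<^sup>2)"
proof -
  have "(\<Sum>j<n. \<Sum>k<n. a j k * x j * x k) = (\<Sum>j<n. \<Sum>k<n. \<Sum>i<n. d i * (u i j * x j) * (u i k * x k))"
    by (intro sum.cong refl) (simp add: decomp sum_distrib_left sum_distrib_right mult_ac)
  also have "\<dots> = (\<Sum>j<n. \<Sum>i<n. \<Sum>k<n. d i * (u i j * x j) * (u i k * x k))"
    by (rule sum.cong[OF refl]) (rule sum.swap)
  also have "\<dots> = (\<Sum>i<n. \<Sum>j<n. \<Sum>k<n. d i * (u i j * x j) * (u i k * x k))"
    by (rule sum.swap)
  also have "\<dots> = (\<Sum>i<n. d i * (\<Sum>j<n. u i j * x j)\<^sup>2)"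
    by (simp add: power2_eq_square sum_distrib_left sum_distrib_right mult_ac)
  finally show ?thesis .
qed

lemma norm_eq: "(\<Sum>j<n. (x j)\<^sup>2) = (\<Sum>i<n. (\<Sum>j<n. u i j * x j)\<^sup>2)"
proof -
  have "(\<Sum>i<n. (\<Sum>j<n. u i j * x j)\<^sup>2) = (\<Sum>i<n. \<Sum>j<n. \<Sum>k<n. (u i j * u i k) * (x j * x k))"
    by (simp add: power2_eq_square sum_distrib_left sum_distrib_right mult_ac)
  also have "\<dots> = (\<Sum>j<n. \<Sum>i<n. \<Sum>k<n. (u i j * u i k) * (x j * x k))"
    by (rule sum.swap)
  also have "\<dots> = (\<Sum>j<n. \<Sum>k<n. (\<Sum>i<n. u i j * u i k) * (x j * x k))"
    unfolding sum_distrib_right by (rule sum.cong[OF refl]) (rule sum.swap)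
  also have "\<dots> = (\<Sum>j<n. \<Sum>k<n. if j = k then x j * x k else 0)"
    by (intro sum.cong refl) (simp add: complete)
  finally show ?thesis by (simp add: power2_eq_square)
qed

lemma quadratic_form_le:
  assumes "\<And>i. i < n \<Longrightarrow> d i \<le> r"
  shows "(\<Sum>j<n. \<Sum>k<n. a j k * x j * x k) \<le> r * (\<Sum>j<n. (x j)\<^sup>2)"
  unfolding quadratic_form norm_eq[of x] sum_distrib_left
  using assms by (intro sum_mono mult_right_mono) auto

lemma eigenvalue_eq_form: "i < n \<Longrightarrow> d i = (\<Sum>j<n. \<Sum>k<n. a j k * u i j * u i k)"
proof -
  assume i: "i < n"
  have "(\<Sum>j<n. \<Sum>k<n. a j k * u i j * u i k) = (\<Sum>j<n. u i j * (\<Sum>k<n. a j k * u i k))"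
    by (simp add: sum_distrib_left mult_ac)
  also have "\<dots> = d i * (\<Sum>j<n. u i j * u i j)"
    using i by (simp add: eigenvector sum_distrib_left mult_ac)
  finally show ?thesis using i by (simp add: orthonormal)
qed

text \<open>The easy half of Perron-Frobenius: for nonnegative entries the form at the
  coordinatewise absolute value of a unit eigenvector is at least
  \<open>\<bar>d i\<bar>\<close>.\<close>

lemma abs_eigenvalue_le:
  assumes "\<And>i. i < n \<Longrightarrow> d i \<le> r" and nonneg: "\<And>j k. j < n \<Longrightarrow> k < n \<Longrightarrow> 0 \<le> a j k" and i: "i < n"
  shows "\<bar>d i\<bar> \<le> r"
proof -
  have "\<bar>d i\<bar> \<le> (\<Sum>j<n. \<bar>\<Sum>k<n. a j k * u i j * u i k\<bar>)"
    unfolding eigenvalue_eq_form[OF i] by (rule sum_abs)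
  also have "\<dots> \<le> (\<Sum>j<n. \<Sum>k<n. \<bar>a j k * u i j * u i k\<bar>)"
    by (intro sum_mono sum_abs)
  also have "\<dots> = (\<Sum>j<n. \<Sum>k<n. a j k * \<bar>u i j\<bar> * \<bar>u i k\<bar>)"
    using nonneg by (intro sum.cong refl) (simp add: abs_mult)
  also have "\<dots> \<le> r * (\<Sum>j<n. \<bar>u i j\<bar>\<^sup>2)"
    using quadratic_form_le[OF assms(1), of "\<lambda>j. \<bar>u i j\<bar>"] by simp
  also have "(\<Sum>j<n. \<bar>u i j\<bar>\<^sup>2) = 1"
    using orthonormal[OF i i] by (simp add: power2_eq_square)
  finally show ?thesis by simp
qed

lemma det_eq: "det (mat n n (\<lambda>(j, k). a j k)) = (\<Prod>i<n. d i)"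
proof -
  define U where "U = mat n n (\<lambda>(i, j). u i j)"
  have U: "U \<in> carrier_mat n n" "transpose_mat U \<in> carrier_mat n n"
    by (simp_all add: U_def)
  have "U * transpose_mat U = 1\<^sub>m n"
    using orthonormal by (intro eq_matI) (auto simp: U_def scalar_prod_def atLeast0LessThan)
  then have "det U * det U = 1"
    using det_mult[OF U] det_transpose[OF U(1)] by simp
  moreover have "mat n n (\<lambda>(j, k). a j k) = transpose_mat U * (mat_diag n d * U)"
    unfolding mat_diag_mult_left[OF U(1)]
    by (intro eq_matI) (auto simp: U_def scalar_prod_def atLeast0LessThan decomp mult_ac)
  moreover have "det (mat_diag n d) = (\<Prod>i<n. d i)"
  proof -
    have "det (mat_diag n d) = prod_list (diag_mat (mat_diag n d))"
      by (rule det_upper_triangular[of _ n]) (auto simp: mat_diag_def)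
    also have "diag_mat (mat_diag n d) = map d [0..<n]"
      by (auto simp: diag_mat_def mat_diag_def intro!: nth_equalityI)
    finally show ?thesis
      by (simp add: prod_list_map_upt)
  qed
  ultimately have "det (mat n n (\<lambda>(j, k). a j k)) = det U * ((\<Prod>i<n. d i) * det U)"
    using det_mult[OF U(2) mult_carrier_mat[OF mat_diag_dim U(1)], of d] det_mult[OF mat_diag_dim U(1), of d]
      det_transpose[OF U(1)] by simp
  also have "\<dots> = (det U * det U) * (\<Prod>i<n. d i)"
    by (simp only: mult_ac)
  finally show ?thesis
    using \<open>det U * det U = 1\<close> by simp
qed

text \<open>Relabelling brings four chosen vertices to the front while \<open>d\<close>, and so the
  index of the largest eigenvalue, stays as it is.\<close>

lemma permute:
  assumes p: "bij_betw p {..<n} {..<n}"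
  shows "eigenbasis n (\<lambda>i j. a (p i) (p j)) (\<lambda>i j. u i (p j)) d"
proof
  fix i k assume "i < n" "k < n"
  have "(\<Sum>j<n. u i (p j) * u k (p j)) = (\<Sum>j<n. u i j * u k j)"
    by (rule sum.reindex_bij_betw[OF p])
  then show "(\<Sum>j<n. u i (p j) * u k (p j)) = (if i = k then 1 else 0)"
    using orthonormal \<open>i < n\<close> \<open>k < n\<close> by simp
next
  fix j k assume jk: "j < n" "k < n"
  then have p_less: "p j < n" "p k < n" and "p j = p k \<longleftrightarrow> j = k"
    using bij_betwE[OF p] inj_on_eq_iff[OF bij_betw_imp_inj_on[OF p], of j k] by simp_all
  then show "(\<Sum>i<n. u i (p j) * u i (p k)) = (if j = k then 1 else 0)"
    by (simp add: complete)
  show "a (p j) (p k) = (\<Sum>i<n. d i * u i (p j) * u i (p k))"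
    using p_less by (rule decomp)
qed

end

lemma eigenbasis_exists:
  fixes A :: "real mat"
  assumes A: "A \<in> carrier_mat n n" and sym: "transpose_mat A = A"
  shows "\<exists>u d. eigenbasis n (\<lambda>i j. A $$ (i, j)) u d \<and> char_poly A = (\<Prod>x\<leftarrow>map d [0..<n]. [:- x, 1:])"
proof -
  obtain Q d where Q: "Q \<in> carrier_mat n n" "transpose_mat Q * Q = 1\<^sub>m n"
      "transpose_mat Q * A * Q = mat_diag n d"
    using real_spectral_matrix[OF A sym] by blast
  have Qt: "transpose_mat Q \<in> carrier_mat n n" using Q(1) by simp
  have QQt: "Q * transpose_mat Q = 1\<^sub>m n"
    by (rule mat_mult_left_right_inverse[OF Qt Q(1,2)])
  have A_eq: "A = Q * mat_diag n d * transpose_mat Q"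
  proof -
    have "Q * mat_diag n d = Q * (transpose_mat Q * (A * Q))"
      unfolding Q(3)[symmetric] assoc_mult_mat[OF Qt A Q(1)] ..
    also have "\<dots> = A * Q"
      using left_mult_one_mat[OF mult_carrier_mat[OF A Q(1)]]
      by (simp add: assoc_mult_mat[OF Q(1) Qt mult_carrier_mat[OF A Q(1)], symmetric] QQt)
    finally show ?thesis
      using A by (simp add: assoc_mult_mat[OF A Q(1) Qt] QQt)
  qed
  have eq: "A $$ (j, k) = (\<Sum>i<n. d i * Q $$ (j, i) * Q $$ (k, i))" if "j < n" "k < n" for j k
  proof -
    have "A $$ (j, k) = (mat n n (\<lambda>(i, j). Q $$ (i, j) * d j) * transpose_mat Q) $$ (j, k)"
      using A_eq unfolding mat_diag_mult_right[OF Q(1)] by (rule arg_cong)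
    then show ?thesis
      using that Q(1) by (simp add: scalar_prod_def atLeast0LessThan mult_ac)
  qed
  have "eigenbasis n (\<lambda>i j. A $$ (i, j)) (\<lambda>i j. Q $$ (j, i)) d"
  proof
    fix i k assume ik: "i < n" "k < n"
    then show "(\<Sum>j<n. Q $$ (j, i) * Q $$ (j, k)) = (if i = k then 1 else 0)"
      using arg_cong[OF Q(2), of "\<lambda>M. M $$ (i, k)"] Q(1) by (simp add: scalar_prod_def atLeast0LessThan)
    show "(\<Sum>j<n. Q $$ (i, j) * Q $$ (k, j)) = (if i = k then 1 else 0)"
      using arg_cong[OF QQt, of "\<lambda>M. M $$ (i, k)"] Q(1) ik by (simp add: scalar_prod_def atLeast0LessThan)
  qed (rule eq)
  moreover have "char_poly A = (\<Prod>x\<leftarrow>map d [0..<n]. [:- x, 1:])"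
  proof -
    have "char_poly A = char_poly (mat_diag n d)"
      by (rule char_poly_similar, rule similar_matI[OF _ QQt Q(2) A_eq])
        (use Q(1) Qt A mat_diag_dim in auto)
    also have "\<dots> = (\<Prod>x\<leftarrow>diag_mat (mat_diag n d). [:- x, 1:])"
      by (rule char_poly_upper_triangular[of _ n]) (auto simp: mat_diag_def)
    also have "diag_mat (mat_diag n d) = map d [0..<n]"
      by (auto simp: diag_mat_def mat_diag_def intro!: nth_equalityI)
    finally show ?thesis .
  qed
  ultimately show ?thesis by blast
qed

section \<open>The sorted list of eigenvalues\<close>

lemma proots_linear_factors: "proots (\<Prod>x\<leftarrow>xs. [:- x, 1:]) = mset (xs :: real list)"
proof (induction xs)
  case (Cons x xs)
  have "(\<Prod>x\<leftarrow>xs. [:- x, 1:]) \<noteq> (0 :: real poly)"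
    by (simp add: prod_list_zero_iff) auto
  then show ?case using Cons proots_mult[of "[:- x, 1:]" "\<Prod>x\<leftarrow>xs. [:- x, 1:]"] by (simp del: mult_pCons_left)
qed simp

text \<open>The factorisation fixes the multiset of roots and sorting fixes the order, so the
  definite description has exactly one solution.\<close>

lemma eigenvalues_eq:
  assumes "char_poly A = (\<Prod>x\<leftarrow>xs. [:- x, 1:])"
  shows "eigenvalues A = rev (sort xs)"
  unfolding eigenvalues_def
proof (rule the_equality)
  have "(\<Prod>x\<leftarrow>rev (sort xs). [:- x, 1:]) = (\<Prod>x\<leftarrow>xs. [:- x, 1:])"
    by (simp only: prod_mset_prod_list[symmetric] mset_map mset_rev mset_sort)
  then show "sorted_wrt (\<ge>) (rev (sort xs)) \<and> char_poly A = (\<Prod>x\<leftarrow>rev (sort xs). [:- x, 1:])"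
    using assms by (simp add: sorted_wrt_rev)
next
  fix es assume es: "sorted_wrt (\<ge>) es \<and> char_poly A = (\<Prod>x\<leftarrow>es. [:- x, 1:])"
  then have "mset es = mset xs"
    using assms proots_linear_factors[of es] proots_linear_factors[of xs] by simp
  moreover have "sorted (rev es)"
    using es by (simp add: sorted_wrt_rev)
  ultimately have "sort xs = rev es"
    by (intro properties_for_sort) auto
  then show "es = rev (sort xs)" by simp
qed

lemma energy_eq:
  assumes "char_poly A = (\<Prod>x\<leftarrow>map d [0..<n]. [:- x, 1:])"
  shows "energy A = (\<Sum>i<n. \<bar>d i\<bar>)"
proof -
  have "energy A = sum_mset (image_mset abs (mset (rev (sort (map d [0..<n])))))"
    unfolding energy_def eigenvalues_eq[OF assms] sum_mset_sum_list[symmetric] mset_map ..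
  also have "\<dots> = (\<Sum>x\<leftarrow>map d [0..<n]. \<bar>x\<bar>)"
    by (simp only: sum_mset_sum_list[symmetric] mset_map mset_rev mset_sort)
  also have "\<dots> = (\<Sum>i<n. \<bar>d i\<bar>)"
    by (simp add: o_def interv_sum_list_conv_sum_set_nat atLeast0LessThan)
  finally show ?thesis .
qed

lemma largest_eigenvalue_attained:
  assumes "char_poly A = (\<Prod>x\<leftarrow>map d [0..<n]. [:- x, 1:])" and "0 < n"
  shows "\<exists>i0<n. d i0 = largest_eigenvalue A \<and> (\<forall>i<n. d i \<le> d i0)"
proof -
  let ?es = "rev (sort (map d [0..<n]))"
  have es: "?es \<noteq> []" "set ?es = d ` {..<n}"
    using assms(2) by (auto simp: atLeast0LessThan simp flip: length_greater_0_conv)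
  then have "hd ?es \<in> d ` {..<n}" by (metis list.set_sel(1))
  then obtain i0 where "i0 < n" "d i0 = hd ?es" by auto
  moreover have "d i \<le> hd ?es" if "i < n" for i
  proof -
    have "d i \<in> set ?es" using es(2) that by auto
    moreover have "sorted_wrt (\<ge>) ?es" by (simp add: sorted_wrt_rev)
    ultimately show ?thesis by (cases ?es) auto
  qed
  ultimately show ?thesis
    unfolding largest_eigenvalue_def eigenvalues_eq[OF assms(1)] by auto
qed

section \<open>Splitting off a unimodular block\<close>

lemma sum_lessThan_add4:
  "(\<Sum>j<m + 4. f j) = f 0 + f 1 + f 2 + f 3 + (\<Sum>v<m. f (v + 4))" for f :: "nat \<Rightarrow> 'a :: comm_monoid_add"
  by (simp add: eval_nat_numeral sum.lessThan_Suc_shift add.assoc del: sum.lessThan_Suc)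

text \<open>The cross product of the coefficient vectors is a solution. If it vanishes, the vectors
  are parallel, and a vector perpendicular to a nonzero pair \<open>(p, q)\<close> in the first two
  coordinates solves both equations.\<close>

lemma exists_orthogonal_3:
  fixes p1 q1 r1 p2 q2 r2 :: real
  shows "\<exists>x y z. (x \<noteq> 0 \<or> y \<noteq> 0 \<or> z \<noteq> 0) \<and> x * p1 + y * q1 + z * r1 = 0 \<and> x * p2 + y * q2 + z * r2 = 0"
proof -
  let ?c1 = "q1 * r2 - r1 * q2" and ?c2 = "r1 * p2 - p1 * r2" and ?c3 = "p1 * q2 - q1 * p2"
  consider "?c1 \<noteq> 0 \<or> ?c2 \<noteq> 0 \<or> ?c3 \<noteq> 0" | "?c1 = 0" "?c2 = 0" "?c3 = 0" "p1 \<noteq> 0 \<or> q1 \<noteq> 0"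
    | "?c1 = 0" "?c2 = 0" "?c3 = 0" "p1 = 0" "q1 = 0" "p2 \<noteq> 0 \<or> q2 \<noteq> 0"
    | "p1 = 0" "q1 = 0" "p2 = 0" "q2 = 0"
    by blast
  then show ?thesis
  proof cases
    case 1
    then show ?thesis
      by (intro exI[of _ ?c1] exI[of _ ?c2] exI[of _ ?c3]) (simp add: algebra_simps)
  next
    case 2
    then show ?thesis
      by (intro exI[of _ "- q1"] exI[of _ p1] exI[of _ 0]) (auto simp: algebra_simps)
  next
    case 3
    then show ?thesis
      by (intro exI[of _ "- q2"] exI[of _ p2] exI[of _ 0]) (auto simp: algebra_simps)
  next
    case 4
    then show ?thesis
      by (intro exI[of _ 1] exI[of _ 0]) simp
  qed
qed

text \<open>The minors again have the form \<open>mat n n\<close>, so \<open>simp\<close> can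
  iterate the expansion for the small sizes.\<close>

lemma det_Suc_mat:
  "det (mat (Suc n) (Suc n) f) =
    (\<Sum>i<Suc n. f (i, 0) * ((-1) ^ i * det (mat n n (\<lambda>(k, l). f (if k < i then k else Suc k, Suc l)))))"
  for f :: "nat \<times> nat \<Rightarrow> 'a :: comm_ring_1"
proof -
  let ?A = "mat (Suc n) (Suc n) f"
  have "mat_delete ?A i 0 = mat n n (\<lambda>(k, l). f (if k < i then k else Suc k, Suc l))" if "i < Suc n" for i
    using that by (intro eq_matI) (auto simp: mat_delete_def)
  then have "(\<Sum>i<Suc n. ?A $$ (i, 0) * cofactor ?A i 0) =
      (\<Sum>i<Suc n. f (i, 0) * ((-1) ^ i * det (mat n n (\<lambda>(k, l). f (if k < i then k else Suc k, Suc l)))))"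
    by (intro sum.cong refl) (simp add: cofactor_def del: sum.lessThan_Suc)
  then show ?thesis
    using laplace_expansion_column[of ?A "Suc n" 0] by simp
qed

lemma det_2_mat: "det (mat 2 2 f) = f (0, 0) * f (1, 1) - f (0, 1) * f (1, 0)"
  for f :: "nat \<times> nat \<Rightarrow> 'a :: comm_ring_1"
  by (simp add: numeral_2_eq_2 det_Suc_mat algebra_simps)

lemma det_4_mat:
  "det (mat 4 4 f) =
    f (0,0) * (f (1,1) * (f (2,2) * f (3,3) - f (2,3) * f (3,2)) - f (1,2) * (f (2,1) * f (3,3) - f (2,3) * f (3,1)) + f (1,3) * (f (2,1) * f (3,2) - f (2,2) * f (3,1)))
  - f (0,1) * (f (1,0) * (f (2,2) * f (3,3) - f (2,3) * f (3,2)) - f (1,2) * (f (2,0) * f (3,3) - f (2,3) * f (3,0)) + f (1,3) * (f (2,0) * f (3,2) - f (2,2) * f (3,0)))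
  + f (0,2) * (f (1,0) * (f (2,1) * f (3,3) - f (2,3) * f (3,1)) - f (1,1) * (f (2,0) * f (3,3) - f (2,3) * f (3,0)) + f (1,3) * (f (2,0) * f (3,1) - f (2,1) * f (3,0)))
  - f (0,3) * (f (1,0) * (f (2,1) * f (3,2) - f (2,2) * f (3,1)) - f (1,1) * (f (2,0) * f (3,2) - f (2,2) * f (3,0)) + f (1,2) * (f (2,0) * f (3,1) - f (2,1) * f (3,0)))"
  for f :: "nat \<times> nat \<Rightarrow> 'a :: comm_ring_1"
  by (simp add: eval_nat_numeral det_Suc_mat algebra_simps)

section \<open>Signature and determinant of the Schur complement\<close>

text \<open>The first four vertices carry the edges \<open>01\<close> and \<open>23\<close> and, besides these, at most the edges \<open>03\<close> and \<open>13\<close>.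
  Such a block always has determinant \<open>1\<close>, so that splitting it off is possible over the integers.\<close>

locale block_eigenbasis = eigenbasis "m + 4" a u d for m a u d +
  fixes s t :: real
  assumes block: "a 0 0 = 0" "a 1 1 = 0" "a 2 2 = 0" "a 3 3 = 0" "a 0 1 = 1" "a 0 2 = 0" "a 1 2 = 0" "a 2 3 = 1"
    "a 0 3 = s" "a 1 3 = t"
    and st: "0 \<le> s" "s \<le> 1" "0 \<le> t" "t \<le> 1"
begin

lemma a_sym: "j < m + 4 \<Longrightarrow> k < m + 4 \<Longrightarrow> a j k = a k j"
  by (simp add: decomp mult_ac)

lemma block_sym:
  "a (Suc 0) (Suc 0) = 0" "a 0 (Suc 0) = 1" "a (Suc 0) 2 = 0" "a (Suc 0) 3 = t" "a (Suc 0) 0 = 1"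
  "a 2 0 = 0" "a 2 (Suc 0) = 0" "a 3 2 = 1" "a 3 0 = s" "a 3 (Suc 0) = t"
  using a_sym[of 1 0] a_sym[of 2 0] a_sym[of 2 1] a_sym[of 3 2] a_sym[of 3 0] a_sym[of 3 1] block by simp_all

text \<open>The subtracted term is the inverse of the leading block, applied to the columns of \<open>v\<close> and \<open>w\<close>.\<close>

definition "schur v w = a (v + 4) (w + 4)
  - ((a 0 (v + 4) - s * a 2 (v + 4)) * (a 1 (w + 4) - t * a 2 (w + 4))
    + (a 0 (w + 4) - s * a 2 (w + 4)) * (a 1 (v + 4) - t * a 2 (v + 4))
    + a 2 (v + 4) * a 3 (w + 4) + a 2 (w + 4) * a 3 (v + 4))"

lemma form_expand:
  "(\<Sum>j<m + 4. \<Sum>k<m + 4. a j k * x j * x k) =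
    2 * (x 0 * x 1 + s * x 0 * x 3 + t * x 1 * x 3 + x 2 * x 3)
    + 2 * (x 0 * (\<Sum>v<m. a 0 (v + 4) * x (v + 4)) + x 1 * (\<Sum>v<m. a 1 (v + 4) * x (v + 4))
      + x 2 * (\<Sum>v<m. a 2 (v + 4) * x (v + 4)) + x 3 * (\<Sum>v<m. a 3 (v + 4) * x (v + 4)))
    + (\<Sum>v<m. \<Sum>w<m. a (v + 4) (w + 4) * x (v + 4) * x (w + 4))"
proof -
  define L where "L i = (\<Sum>v<m. a i (v + 4) * x (v + 4))" for i
  have col: "(\<Sum>v<m. a (v + 4) i * x (v + 4) * x i) = x i * L i" if "i < 4" for i
    unfolding L_def sum_distrib_left using that by (intro sum.cong refl) (simp add: a_sym[of _ i] mult_ac)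
  have row: "(\<Sum>v<m. a i (v + 4) * x i * x (v + 4)) = x i * L i" for i
    unfolding L_def sum_distrib_left by (intro sum.cong refl) (simp add: mult_ac)
  have "(\<Sum>j<m + 4. \<Sum>k<m + 4. a j k * x j * x k) =
    2 * (x 0 * x 1 + s * x 0 * x 3 + t * x 1 * x 3 + x 2 * x 3)
    + 2 * (x 0 * L 0 + x 1 * L 1 + x 2 * L 2 + x 3 * L 3)
    + (\<Sum>v<m. \<Sum>w<m. a (v + 4) (w + 4) * x (v + 4) * x (w + 4))"
    using col[of 0] col[of 1] col[of 2] col[of 3] row[of 0] row[of 1] row[of 2] row[of 3]
    unfolding sum_lessThan_add4
    by (simp add: block block_sym sum.distrib algebra_simps)
  then show ?thesis by (simp add: L_def)
qed

lemma schur_form: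
  "(\<Sum>v<m. \<Sum>w<m. schur v w * y v * y w) = (\<Sum>v<m. \<Sum>w<m. a (v + 4) (w + 4) * y v * y w)
    - 2 * (((\<Sum>v<m. a 0 (v + 4) * y v) - s * (\<Sum>v<m. a 2 (v + 4) * y v))
        * ((\<Sum>v<m. a 1 (v + 4) * y v) - t * (\<Sum>v<m. a 2 (v + 4) * y v))
      + (\<Sum>v<m. a 2 (v + 4) * y v) * (\<Sum>v<m. a 3 (v + 4) * y v))"
proof -
  define f g where "f = (\<lambda>v. (a 0 (v + 4) - s * a 2 (v + 4)) * y v)" and "g = (\<lambda>v. (a 1 (v + 4) - t * a 2 (v + 4)) * y v)"
  define h k where "h = (\<lambda>v. a 2 (v + 4) * y v)" and "k = (\<lambda>v. a 3 (v + 4) * y v)"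
  have "(\<Sum>v<m. \<Sum>w<m. schur v w * y v * y w) = (\<Sum>v<m. \<Sum>w<m. a (v + 4) (w + 4) * y v * y w
      - (f v * g w + g v * f w + h v * k w + k v * h w))"
    by (intro sum.cong refl) (simp add: schur_def f_def g_def h_def k_def algebra_simps)
  also have "\<dots> = (\<Sum>v<m. \<Sum>w<m. a (v + 4) (w + 4) * y v * y w) - 2 * (sum f {..<m} * sum g {..<m} + sum h {..<m} * sum k {..<m})"
    by (simp add: sum_subtractf sum.distrib flip: sum_product)
  also have "sum f {..<m} = (\<Sum>v<m. a 0 (v + 4) * y v) - s * (\<Sum>v<m. a 2 (v + 4) * y v)"
    by (simp only: f_def left_diff_distrib sum_subtractf sum_distrib_left mult.assoc)
  also have "sum g {..<m} = (\<Sum>v<m. a 1 (v + 4) * y v) - t * (\<Sum>v<m. a 2 (v + 4) * y v)"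
    by (simp only: g_def left_diff_distrib sum_subtractf sum_distrib_left mult.assoc)
  finally show ?thesis by (simp add: h_def k_def)
qed

text \<open>A vector split along the first four coordinates, where the form is positive on the span of
  \<open>e\<^sub>0 + e\<^sub>1\<close> and \<open>2 e\<^sub>2 + e\<^sub>3\<close>, and its orthogonal complement, where the form is \<^const>\<open>schur\<close>.\<close>

definition split_vec :: "(nat \<Rightarrow> real) \<Rightarrow> real \<Rightarrow> real \<Rightarrow> real \<Rightarrow> nat \<Rightarrow> real" where
  "split_vec y \<alpha> \<beta> \<gamma> j = (let L = (\<lambda>i. \<Sum>v<m. a i (v + 4) * y v) in
    if j = 0 then \<alpha> - \<gamma> * (L 1 - t * L 2) else if j = 1 then \<alpha> - \<gamma> * (L 0 - s * L 2)
    else if j = 2 then 2 * \<beta> - \<gamma> * (L 3 - s * L 1 - t * L 0 + 2 * s * t * L 2)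
    else if j = 3 then \<beta> - \<gamma> * L 2 else \<gamma> * y (j - 4))"

text \<open>The corrections of the first four coordinates are minus the inverse block applied to
  \<open>L\<close>. They make the part with factor \<open>\<gamma>\<close> orthogonal to these
  coordinates, so no mixed terms survive.\<close>

lemma split_vec_form:
  "(\<Sum>j<m + 4. \<Sum>k<m + 4. a j k * split_vec y \<alpha> \<beta> \<gamma> j * split_vec y \<alpha> \<beta> \<gamma> k) =
    2 * \<alpha>\<^sup>2 + 2 * \<alpha> * \<beta> * (s + t) + 4 * \<beta>\<^sup>2 + \<gamma>\<^sup>2 * (\<Sum>v<m. \<Sum>w<m. schur v w * y v * y w)"
proof -
  define L where "L i = (\<Sum>v<m. a i (v + 4) * y v)" for i
  define S where "S = (\<Sum>v<m. \<Sum>w<m. a (v + 4) (w + 4) * y v * y w)"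
  have L: "(\<Sum>v<m. a i (v + 4) * split_vec y \<alpha> \<beta> \<gamma> (v + 4)) = \<gamma> * L i" for i
    by (simp add: split_vec_def Let_def L_def sum_distrib_left mult_ac)
  have S: "(\<Sum>v<m. \<Sum>w<m. a (v + 4) (w + 4) * split_vec y \<alpha> \<beta> \<gamma> (v + 4) * split_vec y \<alpha> \<beta> \<gamma> (w + 4)) = \<gamma>\<^sup>2 * S"
    by (simp add: split_vec_def Let_def S_def sum_distrib_left power2_eq_square mult_ac)
  have x: "split_vec y \<alpha> \<beta> \<gamma> 0 = \<alpha> - \<gamma> * (L 1 - t * L 2)" "split_vec y \<alpha> \<beta> \<gamma> 1 = \<alpha> - \<gamma> * (L 0 - s * L 2)"
    "split_vec y \<alpha> \<beta> \<gamma> 2 = 2 * \<beta> - \<gamma> * (L 3 - s * L 1 - t * L 0 + 2 * s * t * L 2)"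
    "split_vec y \<alpha> \<beta> \<gamma> 3 = \<beta> - \<gamma> * L 2"
    by (simp_all add: split_vec_def Let_def L_def)
  show ?thesis
    unfolding form_expand L S schur_form unfolding L_def[symmetric] S_def[symmetric] x
    by (simp add: algebra_simps power2_eq_square)
qed

lemma split_vec_linear:
  "(\<Sum>j<m + 4. f j * split_vec y \<alpha> \<beta> \<gamma> j) = \<alpha> * (f 0 + f 1) + \<beta> * (2 * f 2 + f 3)
    + \<gamma> * (\<Sum>j<m + 4. f j * split_vec y 0 0 1 j)"
  unfolding sum_lessThan_add4
  by (simp add: split_vec_def Let_def sum_distrib_left algebra_simps)

text \<open>The expression is affine in \<open>s + t\<close>, which lies between 0 and 2, and
  positive at both ends. With \<open>e2 + e3\<close> in place of \<open>2 e2 + e3\<close> it would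
  degenerate to \<open>2 (\<alpha> + \<beta>)^2\<close> at \<open>s = t = 1\<close>.\<close>

lemma hyperbolic_pos:
  assumes "\<alpha> \<noteq> 0 \<or> \<beta> \<noteq> 0"
  shows "0 < 2 * \<alpha>\<^sup>2 + 2 * \<alpha> * \<beta> * (s + t) + 4 * \<beta>\<^sup>2"
proof -
  have "2 * \<alpha>\<^sup>2 + 2 * \<alpha> * \<beta> * (s + t) + 4 * \<beta>\<^sup>2
      = (s + t) * (\<alpha> + \<beta>)\<^sup>2 + (2 - (s + t)) * (\<alpha>\<^sup>2 + \<beta>\<^sup>2) + 2 * \<beta>\<^sup>2"
    by (simp add: algebra_simps power2_eq_square)
  moreover have "0 \<le> (s + t) * (\<alpha> + \<beta>)\<^sup>2" "0 \<le> (2 - (s + t)) * (\<alpha>\<^sup>2 + \<beta>\<^sup>2)"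
    using st by (auto intro!: mult_nonneg_nonneg)
  moreover have "0 < 2 * \<alpha>\<^sup>2 + 2 * \<alpha> * \<beta> * (s + t) + 4 * \<beta>\<^sup>2" if "\<beta> = 0"
    using that assms by simp
  ultimately show ?thesis
    by (cases "\<beta> = 0") (simp, smt (verit) zero_less_power2)
qed

text \<open>The block carries a positive plane, and a nonzero vector of this plane is orthogonal to
  the eigenvector of \<open>i0\<close>; the form could not be positive there if all other
  eigenvalues were nonpositive.\<close>

lemma second_positive:
  assumes i0: "i0 < m + 4"
  shows "\<exists>i<m + 4. i \<noteq> i0 \<and> 0 < d i"
proof (rule ccontr)
  assume "\<not> ?thesis"
  then have neg: "d i \<le> 0" if "i < m + 4" "i \<noteq> i0" for i
    using that by force
  define p q where "p = u i0 0 + u i0 1" and "q = 2 * u i0 2 + u i0 3"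
  define \<alpha> \<beta> where "\<alpha> = (if p = 0 \<and> q = 0 then 1 else q)" and "\<beta> = (if p = 0 \<and> q = 0 then 0 else - p)"
  have nz: "\<alpha> \<noteq> 0 \<or> \<beta> \<noteq> 0" and "\<alpha> * p + \<beta> * q = 0"
    by (auto simp: \<alpha>_def \<beta>_def)
  then have orth: "(\<Sum>j<m + 4. u i0 j * split_vec (\<lambda>_. 0) \<alpha> \<beta> 0 j) = 0"
    by (subst split_vec_linear) (simp add: p_def q_def)
  have "0 < (\<Sum>j<m + 4. \<Sum>k<m + 4. a j k * split_vec (\<lambda>_. 0) \<alpha> \<beta> 0 j * split_vec (\<lambda>_. 0) \<alpha> \<beta> 0 k)"
    using hyperbolic_pos[OF nz] by (simp add: split_vec_form)
  also have "\<dots> \<le> 0"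
    unfolding quadratic_form using neg orth
    by (intro sum_nonpos) (metis lessThan_iff mult_nonpos_nonneg mult_zero_right power_zero_numeral zero_le_power2)
  finally show False by simp
qed

text \<open>A nonnegative value at \<open>y\<close> would extend the positive plane of the block to
  a three-dimensional space with nonnegative form. A nonzero vector of that space is orthogonal to
  the eigenvectors of \<open>i0\<close> and \<open>i1\<close>, where the form is negative.\<close>

lemma schur_negative_definite:
  assumes i: "i0 < m + 4" "i1 < m + 4"
    and neg: "\<And>i. i < m + 4 \<Longrightarrow> i \<noteq> i0 \<Longrightarrow> i \<noteq> i1 \<Longrightarrow> d i < 0"
    and y: "v < m" "y v \<noteq> 0"
  shows "(\<Sum>v<m. \<Sum>w<m. schur v w * y v * y w) < 0"
proof (rule ccontr)
  assume "\<not> ?thesis"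
  then have nonneg: "0 \<le> (\<Sum>v<m. \<Sum>w<m. schur v w * y v * y w)" by simp
  define Z where "Z i = (\<Sum>j<m + 4. u i j * split_vec y 0 0 1 j)" for i
  obtain \<alpha> \<beta> \<gamma> where nz: "\<alpha> \<noteq> 0 \<or> \<beta> \<noteq> 0 \<or> \<gamma> \<noteq> 0"
    and eqs: "\<alpha> * (u i0 0 + u i0 1) + \<beta> * (2 * u i0 2 + u i0 3) + \<gamma> * Z i0 = 0"
      "\<alpha> * (u i1 0 + u i1 1) + \<beta> * (2 * u i1 2 + u i1 3) + \<gamma> * Z i1 = 0"
    using exists_orthogonal_3 by blast
  define x where "x = split_vec y \<alpha> \<beta> \<gamma>"
  define \<xi> where "\<xi> i = (\<Sum>j<m + 4. u i j * x j)" for i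
  have orth: "\<xi> i0 = 0" "\<xi> i1 = 0"
    using eqs unfolding \<xi>_def x_def by (subst split_vec_linear; simp add: Z_def)+
  have form: "(\<Sum>i<m + 4. d i * (\<xi> i)\<^sup>2) = 2 * \<alpha>\<^sup>2 + 2 * \<alpha> * \<beta> * (s + t) + 4 * \<beta>\<^sup>2
      + \<gamma>\<^sup>2 * (\<Sum>v<m. \<Sum>w<m. schur v w * y v * y w)"
    unfolding \<xi>_def quadratic_form[symmetric] x_def by (rule split_vec_form)
  have term_le: "d i * (\<xi> i)\<^sup>2 \<le> 0" if "i < m + 4" for i
    using that neg[of i] orth by (cases "i = i0 \<or> i = i1") (auto simp: mult_nonpos_nonneg)
  then have le: "(\<Sum>i<m + 4. d i * (\<xi> i)\<^sup>2) \<le> 0"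
    by (intro sum_nonpos) auto
  have "\<alpha> = 0 \<and> \<beta> = 0"
    using hyperbolic_pos[of \<alpha> \<beta>] le nonneg form by (smt (verit) mult_nonneg_nonneg zero_le_power2)
  then have "\<gamma> \<noteq> 0" and ge: "0 \<le> (\<Sum>i<m + 4. d i * (\<xi> i)\<^sup>2)"
    using nz form nonneg by auto
  have "(\<Sum>i<m + 4. - (d i * (\<xi> i)\<^sup>2)) = 0"
    using le ge by (simp add: sum_negf)
  then have "\<forall>i\<in>{..<m + 4}. - (d i * (\<xi> i)\<^sup>2) = 0"
    using term_le by (subst (asm) sum_nonneg_eq_0_iff) auto
  then have "d i = 0 \<or> \<xi> i = 0" if "i < m + 4" for i
    using that by simp
  then have "\<xi> i = 0" if "i < m + 4" for i
    using that orth neg[of i] by (cases "i = i0 \<or> i = i1") force+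
  then have "(\<Sum>j<m + 4. (x j)\<^sup>2) = 0"
    unfolding norm_eq[of x] \<xi>_def[symmetric] by simp
  then have "x (v + 4) = 0"
    using y(1) by (subst (asm) sum_nonneg_eq_0_iff) auto
  then show False
    using y(2) \<open>\<gamma> \<noteq> 0\<close> by (simp add: x_def split_vec_def Let_def)
qed

lemma det_schur: "det (mat (m + 4) (m + 4) (\<lambda>(j, k). a j k)) = det (mat m m (\<lambda>(v, w). schur v w))"
proof -
  define M C D B where "M = mat 4 4 (\<lambda>(j, k). a j k)" and "C = mat 4 m (\<lambda>(j, v). a j (v + 4))"
    and "D = mat m m (\<lambda>(v, w). a (v + 4) (w + 4))" and "B = mat m m (\<lambda>(v, w). schur v w)"
  define Ct where "Ct = mat m 4 (\<lambda>(v, j). a j (v + 4))"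
  \<comment> \<open>\<open>X\<close> is minus the inverse of \<open>M\<close> times
    \<open>C\<close>, so the column operation below clears the upper right block.\<close>
  define X where "X = mat 4 m (\<lambda>(j, v). if j = 0 then - (a 1 (v + 4) - t * a 2 (v + 4))
    else if j = 1 then - (a 0 (v + 4) - s * a 2 (v + 4))
    else if j = 2 then - (a 3 (v + 4) - s * a 1 (v + 4) - t * a 0 (v + 4) + 2 * s * t * a 2 (v + 4))
    else - a 2 (v + 4))"
  have dims: "M \<in> carrier_mat 4 4" "C \<in> carrier_mat 4 m" "D \<in> carrier_mat m m" "B \<in> carrier_mat m m"
    "Ct \<in> carrier_mat m 4" "X \<in> carrier_mat 4 m"
    by (simp_all add: M_def C_def D_def B_def Ct_def X_def)
  have A: "mat (m + 4) (m + 4) (\<lambda>(j, k). a j k) = four_block_mat M C Ct D"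
    by (rule eq_matI) (auto simp: M_def C_def Ct_def D_def a_sym)
  have sum4: "(\<Sum>j<4. f j) = f 0 + f 1 + f 2 + f 3" for f :: "nat \<Rightarrow> real"
    using sum_lessThan_add4[of f 0] by simp
  have less4: "j < 4 \<longleftrightarrow> j = 0 \<or> j = 1 \<or> j = 2 \<or> j = 3" for j :: nat
    by auto
  have MX: "M * X + C = 0\<^sub>m 4 m"
    by (rule eq_matI)
      (auto simp: M_def X_def C_def scalar_prod_def atLeast0LessThan sum4 less4 block block_sym algebra_simps)
  have CX: "Ct * X + D = B"
    by (rule eq_matI)
      (auto simp: Ct_def X_def D_def B_def schur_def scalar_prod_def atLeast0LessThan sum4 algebra_simps)
  have "four_block_mat M C Ct D * four_block_mat (1\<^sub>m 4) X (0\<^sub>m m 4) (1\<^sub>m m) = four_block_mat M (0\<^sub>m 4 m) Ct B"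
    using dims by (subst mult_four_block_mat[of _ 4 4 _ m _ m _ _ 4 _ m]) (auto simp: MX CX)
  moreover have "det (four_block_mat M C Ct D * four_block_mat (1\<^sub>m 4) X (0\<^sub>m m 4) (1\<^sub>m m))
      = det (four_block_mat M C Ct D) * det (four_block_mat (1\<^sub>m 4) X (0\<^sub>m m 4) (1\<^sub>m m))"
    using dims by (intro det_mult[of _ "4 + m"]) auto
  moreover have "det (four_block_mat (1\<^sub>m 4) X (0\<^sub>m m 4) (1\<^sub>m m)) = 1"
    using dims by (subst det_four_block_mat_lower_left_zero[of _ 4 _ m]) auto
  moreover have "det (four_block_mat M (0\<^sub>m 4 m) Ct B) = det M * det B"
    using dims by (intro det_four_block_mat_upper_right_zero[of _ 4 _ m]) auto
  moreover have "det M = 1"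
    unfolding M_def det_4_mat by (simp add: block block_sym)
  ultimately show ?thesis
    unfolding A B_def by simp
qed

end

section \<open>Even positive definite forms in four variables\<close>

text \<open>An even positive definite integral form in four variables does not have determinant \<open>1\<close> or \<open>2\<close>. Only norms
  \<open>2\<close> and \<open>4\<close> occur here, which leaves finitely many Gram matrices.\<close>

definition gram_det :: "int \<Rightarrow> int \<Rightarrow> int \<Rightarrow> int \<Rightarrow> int \<Rightarrow> int \<Rightarrow> int \<Rightarrow> int \<Rightarrow> int \<Rightarrow> int \<Rightarrow> int" where
  "gram_det d0 d1 d2 d3 g01 g02 g03 g12 g13 g23 =
    d0 * d1 * d2 * d3 + 2 * d0 * g12 * g13 * g23 + 2 * d1 * g02 * g03 * g23 + 2 * d2 * g01 * g03 * g13 + 2 * d3 * g01 * g02 * g12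
    - d0 * d1 * (g23 * g23) - d0 * d2 * (g13 * g13) - d0 * d3 * (g12 * g12) - d1 * d2 * (g03 * g03) - d1 * d3 * (g02 * g02) - d2 * d3 * (g01 * g01)
    + g01 * g01 * (g23 * g23) + g02 * g02 * (g13 * g13) + g03 * g03 * (g12 * g12)
    - 2 * g01 * g02 * g13 * g23 - 2 * g01 * g03 * g12 * g23 - 2 * g02 * g03 * g12 * g13"

definition pos_def_4 :: "int \<Rightarrow> int \<Rightarrow> int \<Rightarrow> int \<Rightarrow> int \<Rightarrow> int \<Rightarrow> int \<Rightarrow> int \<Rightarrow> int \<Rightarrow> int \<Rightarrow> bool" where
  "pos_def_4 d0 d1 d2 d3 g01 g02 g03 g12 g13 g23 \<longleftrightarrow> (\<forall>x0 x1 x2 x3. x0 \<noteq> 0 \<or> x1 \<noteq> 0 \<or> x2 \<noteq> 0 \<or> x3 \<noteq> 0 \<longrightarrow>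
    0 < d0 * x0 * x0 + d1 * x1 * x1 + d2 * x2 * x2 + d3 * x3 * x3 + 2 * (g01 * x0 * x1 + g02 * x0 * x2 + g03 * x0 * x3
      + g12 * x1 * x2 + g13 * x1 * x3 + g23 * x2 * x3))"

text \<open>By definiteness two vectors of norm 2 have inner product at most 1 in absolute value,
  and vectors of norms 4 and 2 at most 2. These are the ranges enumerated here and in
  \<open>gram_det_norm_4\<close>.\<close>

lemma gram_det_norm_2:
  "list_all (\<lambda>g12. list_all (\<lambda>g13. list_all (\<lambda>g23. list_all (\<lambda>g01. list_all (\<lambda>g02. list_all (\<lambda>g03.
    let x = gram_det 2 2 2 2 g01 g02 g03 g12 g13 g23 in x \<noteq> 1 \<and> x \<noteq> 2)
    [-1..1]) [-1..1]) [-1..1]) [-1..1]) [-1..1]) [-1..1]"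
  by code_simp

lemma gram_det_norm_4:
  "list_all (\<lambda>g12. list_all (\<lambda>g13. list_all (\<lambda>g23. list_all (\<lambda>g01. list_all (\<lambda>g02. list_all (\<lambda>g03.
    let x = gram_det 4 2 2 2 g01 g02 g03 g12 g13 g23 in x \<noteq> 1 \<and> x \<noteq> 2)
    [-2..2]) [-2..2]) [-2..2]) [-1..1]) [-1..1]) [-1..1]"
  by code_simp

lemma gram_det_one_norm_4:
  assumes pd: "pos_def_4 d0 2 2 2 g01 g02 g03 g12 g13 g23" and d0: "d0 = 2 \<or> d0 = 4"
  shows "gram_det d0 2 2 2 g01 g02 g03 g12 g13 g23 \<notin> {1, 2}"
proof -
  note pd' = pd[unfolded pos_def_4_def, rule_format]
  have b: "\<bar>g12\<bar> \<le> 1" "\<bar>g13\<bar> \<le> 1" "\<bar>g23\<bar> \<le> 1"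
    using pd'[of 0 1 1 0] pd'[of 0 1 "-1" 0] pd'[of 0 1 0 1] pd'[of 0 1 0 "-1"] pd'[of 0 0 1 1] pd'[of 0 0 1 "-1"]
    by auto
  have g: "\<bar>g01\<bar> \<le> d0 div 2" "\<bar>g02\<bar> \<le> d0 div 2" "\<bar>g03\<bar> \<le> d0 div 2"
    using pd'[of 1 1 0 0] pd'[of 1 "-1" 0 0] pd'[of 1 0 1 0] pd'[of 1 0 "-1" 0] pd'[of 1 0 0 1] pd'[of 1 0 0 "-1"] d0
    by auto
  have b': "g12 \<in> {-1..1}" "g13 \<in> {-1..1}" "g23 \<in> {-1..1}"
    using b by auto
  show ?thesis
    using d0
  proof
    assume d0: "d0 = 2"
    then have "g01 \<in> {-1..1}" "g02 \<in> {-1..1}" "g03 \<in> {-1..1}"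
      using g by auto
    from gram_det_norm_2[unfolded list_all_iff set_upto, rule_format, OF b' this]
    show ?thesis using d0 by (simp add: Let_def)
  next
    assume d0: "d0 = 4"
    then have "g01 \<in> {-2..2}" "g02 \<in> {-2..2}" "g03 \<in> {-2..2}"
      using g by auto
    from gram_det_norm_4[unfolded list_all_iff set_upto, rule_format, OF b' this]
    show ?thesis using d0 by (simp add: Let_def)
  qed
qed

text \<open>If \<open>v\<close> and \<open>w\<close> both have norm \<open>4\<close> and inner product \<open>3\<close>, then \<open>w - v\<close> has norm \<open>2\<close>.\<close>

lemma gram_det_first_norm_4:
  assumes pd: "pos_def_4 4 d1 d2 d3 g01 g02 g03 g12 g13 g23"
    and d: "d1 = 2 \<or> d1 = 4 \<and> g01 = 3" "d2 = 2 \<or> d2 = 4 \<and> g02 = 3" "d3 = 2 \<or> d3 = 4 \<and> g03 = 3"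
  shows "gram_det 4 d1 d2 d3 g01 g02 g03 g12 g13 g23 \<notin> {1, 2}"
proof -
  \<comment> \<open>\<open>e\<close> marks vectors of norm 4. Subtracting the first vector from the
    marked ones is a unimodular change of basis that leaves norms 4, 2, 2, 2. Written in terms of
    the marks, the determinant identity is purely polynomial.\<close>
  define e :: "int \<Rightarrow> int" where "e d = (if d = 4 then 1 else 0)" for d
  define e1 e2 e3 where "e1 = e d1" and "e2 = e d2" and "e3 = e d3"
  define h01 h02 h03 h12 h13 h23 where "h01 = g01 - 4 * e1" and "h02 = g02 - 4 * e2" and "h03 = g03 - 4 * e3"
    and "h12 = g12 - e1 * g02 - e2 * g01 + 4 * e1 * e2"
    and "h13 = g13 - e1 * g03 - e3 * g01 + 4 * e1 * e3"
    and "h23 = g23 - e2 * g03 - e3 * g02 + 4 * e2 * e3"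
  have d_eq: "d1 = 2 + 2 * e1 * g01 - 4 * e1 * e1" "d2 = 2 + 2 * e2 * g02 - 4 * e2 * e2" "d3 = 2 + 2 * e3 * g03 - 4 * e3 * e3"
    using d by (auto simp: e1_def e2_def e3_def e_def)
  have "pos_def_4 4 2 2 2 h01 h02 h03 h12 h13 h23"
    unfolding pos_def_4_def
  proof (intro allI impI)
    fix x0 x1 x2 x3 :: int
    assume "x0 \<noteq> 0 \<or> x1 \<noteq> 0 \<or> x2 \<noteq> 0 \<or> x3 \<noteq> 0"
    then have "x0 - e1 * x1 - e2 * x2 - e3 * x3 \<noteq> 0 \<or> x1 \<noteq> 0 \<or> x2 \<noteq> 0 \<or> x3 \<noteq> 0"
      by auto
    from pd[unfolded pos_def_4_def, rule_format, OF this]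
    show "0 < 4 * x0 * x0 + 2 * x1 * x1 + 2 * x2 * x2 + 2 * x3 * x3 + 2 * (h01 * x0 * x1 + h02 * x0 * x2 + h03 * x0 * x3
      + h12 * x1 * x2 + h13 * x1 * x3 + h23 * x2 * x3)"
      unfolding d_eq by (simp add: h01_def h02_def h03_def h12_def h13_def h23_def algebra_simps)
  qed
  moreover have "gram_det 4 d1 d2 d3 g01 g02 g03 g12 g13 g23 = gram_det 4 2 2 2 h01 h02 h03 h12 h13 h23"
    unfolding d_eq gram_det_def h01_def h02_def h03_def h12_def h13_def h23_def by (simp add: algebra_simps)
  ultimately show ?thesis
    using gram_det_one_norm_4[of 4 h01 h02 h03 h12 h13 h23] by simp
qed

text \<open>A vector of norm 4, if there is one, can be put first: exchanging two basis vectors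
  preserves definiteness and determinant.\<close>

lemma gram_det_not_1_2:
  assumes pd: "pos_def_4 d0 d1 d2 d3 g01 g02 g03 g12 g13 g23"
    and d: "d0 \<in> {2, 4}" "d1 \<in> {2, 4}" "d2 \<in> {2, 4}" "d3 \<in> {2, 4}"
    and g: "d0 = 4 \<Longrightarrow> d1 = 4 \<Longrightarrow> g01 = 3" "d0 = 4 \<Longrightarrow> d2 = 4 \<Longrightarrow> g02 = 3" "d0 = 4 \<Longrightarrow> d3 = 4 \<Longrightarrow> g03 = 3"
      "d1 = 4 \<Longrightarrow> d2 = 4 \<Longrightarrow> g12 = 3" "d1 = 4 \<Longrightarrow> d3 = 4 \<Longrightarrow> g13 = 3" "d2 = 4 \<Longrightarrow> d3 = 4 \<Longrightarrow> g23 = 3"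
  shows "gram_det d0 d1 d2 d3 g01 g02 g03 g12 g13 g23 \<notin> {1, 2}"
proof -
  note pd' = pd[unfolded pos_def_4_def, rule_format]
  consider "d0 = 4" | "d1 = 4" | "d2 = 4" | "d3 = 4" | "d0 = 2" "d1 = 2" "d2 = 2" "d3 = 2"
    using d by auto
  then show ?thesis
  proof cases
    case 1
    then show ?thesis using gram_det_first_norm_4 pd d g by blast
  next
    case 2
    have "pos_def_4 4 d0 d2 d3 g01 g12 g13 g02 g03 g23"
      unfolding pos_def_4_def
    proof (intro allI impI)
      fix x1 x0 x2 x3 :: int
      assume "x1 \<noteq> 0 \<or> x0 \<noteq> 0 \<or> x2 \<noteq> 0 \<or> x3 \<noteq> 0"
      then show "0 < 4 * x1 * x1 + d0 * x0 * x0 + d2 * x2 * x2 + d3 * x3 * x3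
          + 2 * (g01 * x1 * x0 + g12 * x1 * x2 + g13 * x1 * x3 + g02 * x0 * x2 + g03 * x0 * x3 + g23 * x2 * x3)"
        using pd'[of x0 x1 x2 x3] 2 by (auto simp: algebra_simps)
    qed
    moreover have "gram_det d0 4 d2 d3 g01 g02 g03 g12 g13 g23 = gram_det 4 d0 d2 d3 g01 g12 g13 g02 g03 g23"
      by (simp add: gram_det_def algebra_simps)
    ultimately show ?thesis
      using gram_det_first_norm_4[of d0 d2 d3 g01 g12 g13 g02 g03 g23] d g 2 by auto
  next
    case 3
    have "pos_def_4 4 d1 d0 d3 g12 g02 g23 g01 g13 g03"
      unfolding pos_def_4_def
    proof (intro allI impI)
      fix x2 x1 x0 x3 :: int
      assume "x2 \<noteq> 0 \<or> x1 \<noteq> 0 \<or> x0 \<noteq> 0 \<or> x3 \<noteq> 0"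
      then show "0 < 4 * x2 * x2 + d1 * x1 * x1 + d0 * x0 * x0 + d3 * x3 * x3
          + 2 * (g12 * x2 * x1 + g02 * x2 * x0 + g23 * x2 * x3 + g01 * x1 * x0 + g13 * x1 * x3 + g03 * x0 * x3)"
        using pd'[of x0 x1 x2 x3] 3 by (auto simp: algebra_simps)
    qed
    moreover have "gram_det d0 d1 4 d3 g01 g02 g03 g12 g13 g23 = gram_det 4 d1 d0 d3 g12 g02 g23 g01 g13 g03"
      by (simp add: gram_det_def algebra_simps)
    ultimately show ?thesis
      using gram_det_first_norm_4[of d1 d0 d3 g12 g02 g23 g01 g13 g03] d g 3 by auto
  next
    case 4
    have "pos_def_4 4 d1 d2 d0 g13 g23 g03 g12 g01 g02"
      unfolding pos_def_4_def
    proof (intro allI impI)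
      fix x3 x1 x2 x0 :: int
      assume "x3 \<noteq> 0 \<or> x1 \<noteq> 0 \<or> x2 \<noteq> 0 \<or> x0 \<noteq> 0"
      then show "0 < 4 * x3 * x3 + d1 * x1 * x1 + d2 * x2 * x2 + d0 * x0 * x0
          + 2 * (g13 * x3 * x1 + g23 * x3 * x2 + g03 * x3 * x0 + g12 * x1 * x2 + g01 * x1 * x0 + g02 * x2 * x0)"
        using pd'[of x0 x1 x2 x3] 4 by (auto simp: algebra_simps)
    qed
    moreover have "gram_det d0 d1 d2 4 g01 g02 g03 g12 g13 g23 = gram_det 4 d1 d2 d0 g13 g23 g03 g12 g01 g02"
      by (simp add: gram_det_def algebra_simps)
    ultimately show ?thesis
      using gram_det_first_norm_4[of d1 d2 d0 g13 g23 g03 g12 g01 g02] d g 4 by auto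
  next
    case 5
    then show ?thesis using gram_det_one_norm_4 pd by simp
  qed
qed

section \<open>Parity in odd order\<close>

lemma even_det_symmetric_odd:
  fixes A :: "int mat"
  assumes A: "A \<in> carrier_mat n n" and sym: "\<And>i j. i < n \<Longrightarrow> j < n \<Longrightarrow> A $$ (i, j) = A $$ (j, i)"
    and diag: "\<And>i. i < n \<Longrightarrow> A $$ (i, i) = 0" and n: "odd n"
  shows "even (det A)"
proof -
  \<comment> \<open>\<open>K\<close> is skew-symmetric of odd order, hence singular, and agrees with \<open>A\<close> modulo \<open>2\<close>\<close>
  define K where "K = mat n n (\<lambda>(i, j). if i < j then A $$ (i, j) else - A $$ (i, j))"
  have K: "K \<in> carrier_mat n n" by (simp add: K_def)
  have "transpose_mat K = (-1) \<cdot>\<^sub>m K"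
    using A sym diag by (intro eq_matI) (auto simp: K_def not_less le_less)
  then have "det K = det ((-1) \<cdot>\<^sub>m K)"
    using det_transpose[OF K] by simp
  also have "\<dots> = - det K"
    using n K by (simp add: K_def)
  finally have "det K = 0" by simp
  have "even (\<Prod>i = 0..<n. A $$ (i, p i)) \<longleftrightarrow> even (\<Prod>i = 0..<n. K $$ (i, p i))" if "p permutes {0..<n}" for p
  proof -
    have "even (A $$ (i, p i)) \<longleftrightarrow> even (K $$ (i, p i))" if "i < n" for i
      using permutes_in_image[OF \<open>p permutes {0..<n}\<close>, of i] that by (simp add: K_def)
    then show ?thesis by (auto simp: even_prod_iff)
  qed
  then have "even (det A - det K)"
    unfolding det_def'[OF A] det_def'[OF K] sum_subtractf[symmetric]
    by (intro dvd_sum) (auto simp flip: right_diff_distrib)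
  then show ?thesis using \<open>det K = 0\<close> by simp
qed

lemma prod_neg_even:
  fixes f :: "'a \<Rightarrow> real"
  assumes "\<And>i. i \<in> S \<Longrightarrow> f i < 0" "even (card S)"
  shows "0 < prod f S"
proof -
  have "prod f S = (\<Prod>i\<in>S. (-1) * \<bar>f i\<bar>)"
    using assms(1) by (intro prod.cong) force+
  also have "\<dots> = (\<Prod>i\<in>S. \<bar>f i\<bar>)"
    unfolding prod.distrib prod_constant using assms(2) by simp
  also have "\<dots> > 0"
    using assms(1) by (intro prod_pos) force
  finally show ?thesis .
qed

section \<open>The Schur complement of a graph as an even integral form\<close>

locale block_graph_eigenbasis = block_eigenbasis m a u d s t for m a u d s t +
  assumes zero_one: "\<And>j k. j < m + 4 \<Longrightarrow> k < m + 4 \<Longrightarrow> a j k = 0 \<or> a j k = 1"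
    and diag_zero: "\<And>j. j < m + 4 \<Longrightarrow> a j j = 0"
begin

lemma st_cases: "s = 0 \<or> s = 1" "t = 0 \<or> t = 1"
  using zero_one[of 0 3] zero_one[of 1 3] block by auto

lemma schur_int: "v < m \<Longrightarrow> w < m \<Longrightarrow> of_int \<lfloor>schur v w\<rfloor> = schur v w"
proof -
  assume vw: "v < m" "w < m"
  have int: "a j k \<in> \<int>" if "j < m + 4" "k < m + 4" for j k
    using zero_one[OF that] by auto
  have "s \<in> \<int>" "t \<in> \<int>" using st_cases by auto
  then have "schur v w \<in> \<int>"
    unfolding schur_def using vw by (intro Ints_diff Ints_add Ints_mult int) auto
  then show ?thesis by (auto elim: Ints_cases)
qed

lemma schur_sym: "v < m \<Longrightarrow> w < m \<Longrightarrow> schur v w = schur w v"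
  unfolding schur_def using a_sym[of "v + 4" "w + 4"] by simp

text \<open>Both summands of \<open>- schur v v / 2\<close> are at most 1, so the only possible
  negative values are -2 and -4. The value -4 requires both to be 1, which forces
  \<open>s = t\<close> and determines the four entries in the block rows.\<close>

lemma schur_diag_cases:
  assumes v: "v < m" and neg: "schur v v < 0"
  shows "schur v v = -2 \<or> schur v v = -4 \<and> a 2 (v + 4) = 1 \<and> a 3 (v + 4) = 1 \<and>
    (a 0 (v + 4) - s) * (a 1 (v + 4) - t) = 1 \<and> a 0 (v + 4) = 1 - s \<and> a 1 (v + 4) = 1 - t \<and> s = t"
proof -
  have "schur v v = - 2 * ((a 0 (v + 4) - s * a 2 (v + 4)) * (a 1 (v + 4) - t * a 2 (v + 4)) + a 2 (v + 4) * a 3 (v + 4))"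
    using diag_zero[of "v + 4"] v by (simp add: schur_def algebra_simps)
  moreover have "a j (v + 4) = 0 \<or> a j (v + 4) = 1" if "j < 4" for j
    using zero_one[of j "v + 4"] that v by simp
  from this[of 0] this[of 1] this[of 2] this[of 3] have
    "a 0 (v + 4) = 0 \<or> a 0 (v + 4) = 1" "a 1 (v + 4) = 0 \<or> a 1 (v + 4) = 1"
    "a 2 (v + 4) = 0 \<or> a 2 (v + 4) = 1" "a 3 (v + 4) = 0 \<or> a 3 (v + 4) = 1"
    by simp_all
  ultimately show ?thesis
    using neg st_cases by (elim disjE) (simp_all del: One_nat_def)
qed

text \<open>The two columns agree on the block rows, so the subtracted term is the same as on the
  diagonal, namely 4.\<close>

lemma schur_both_norm_4:
  assumes "v < m" "w < m" "schur v v = -4" "schur w w = -4"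
  shows "schur v w = a (v + 4) (w + 4) - 4"
  using schur_diag_cases[of v] schur_diag_cases[of w] assms st_cases
  unfolding schur_def[of v w] by (elim disjE conjE) (simp_all add: algebra_simps)

context
  fixes i0 i1
  assumes i01: "i0 < m + 4" "i1 < m + 4" "i0 \<noteq> i1" and pos: "0 < d i0" "0 < d i1"
    and neg: "\<And>i. i < m + 4 \<Longrightarrow> i \<noteq> i0 \<Longrightarrow> i \<noteq> i1 \<Longrightarrow> d i < 0"
begin

lemma prod_eq_det_schur: "(\<Prod>i<m + 4. d i) = det (mat m m (\<lambda>(v, w). schur v w))"
  using det_eq det_schur by simp

text \<open>There are \<open>m + 2\<close> negative factors.\<close>

lemma prod_pos_even: "even m \<Longrightarrow> 0 < (\<Prod>i<m + 4. d i)"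
proof -
  assume m: "even m"
  have "(\<Prod>i<m + 4. d i) = d i0 * (d i1 * (\<Prod>i\<in>{..<m + 4} - {i0} - {i1}. d i))"
    using i01 by (subst prod.remove[of _ i0], simp, simp, subst prod.remove[of _ i1]) auto
  moreover have "0 < (\<Prod>i\<in>{..<m + 4} - {i0} - {i1}. d i)"
    using m i01 neg by (intro prod_neg_even) auto
  ultimately show ?thesis using pos by simp
qed

lemma schur_diag_neg: "v < m \<Longrightarrow> schur v v < 0"
proof -
  assume v: "v < m"
  have "(\<Sum>x<m. \<Sum>w<m. schur x w * (if x = v then 1 else 0) * (if w = v then 1 else 0)) < 0"
    by (rule schur_negative_definite[OF i01(1,2) neg v]) auto
  also have "(\<Sum>x<m. \<Sum>w<m. schur x w * (if x = v then 1 else 0) * (if w = v then 1 else 0)) =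
      (\<Sum>x<m. if x = v then (\<Sum>w<m. if w = v then schur x w else 0) else 0)"
    by (intro sum.cong refl) (auto simp: if_distrib[of "\<lambda>c. _ * c"] cong: if_cong)
  also have "\<dots> = schur v v" using v by simp
  finally show ?thesis .
qed

text \<open>The determinant is a multiple of 4 minus a square, hence 0 or 3 modulo 4, and it is
  positive.\<close>

lemma prod_ge_3_order_6:
  assumes m: "m = 2"
  shows "3 \<le> \<bar>\<Prod>i<m + 4. d i\<bar>"
proof -
  define b where "b v w = \<lfloor>schur v w\<rfloor>" for v w
  have b: "schur v w = of_int (b v w)" if "v < 2" "w < 2" for v w
    using schur_int[of v w] that by (simp only: b_def m)
  have even: "even (b v v)" if "v < 2" for v
    using schur_diag_cases[of v] schur_diag_neg[of v] that m by (auto simp: b_def)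
  define D where "D = b 0 0 * b 1 1 - b 0 1 * b 0 1"
  have "det (mat 2 2 (\<lambda>(v, w). schur v w)) = of_int D"
    unfolding det_2_mat using b[of 0 0] b[of 1 1] b[of 0 1] b[of 1 0] schur_sym[of 0 1] by (simp add: D_def m)
  then have D: "(\<Prod>i<m + 4. d i) = of_int D"
    using prod_eq_det_schur by (simp add: m)
  then have "0 < D"
    using prod_pos_even m by (metis even_numeral of_int_0_less_iff)
  obtain x y where xy: "b 0 0 = 2 * x" "b 1 1 = 2 * y"
    using even[of 0] even[of 1] by (auto elim!: evenE)
  have "D mod 4 = 0 \<or> D mod 4 = 3"
  proof (cases "even (b 0 1)")
    case True
    then obtain z where z: "b 0 1 = 2 * z" by (elim evenE)
    have "D = 4 * (x * y - z * z)" unfolding D_def xy z by (simp add: algebra_simps)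
    then show ?thesis by simp
  next
    case False
    then obtain z where z: "b 0 1 = 2 * z + 1" by (elim oddE)
    have "D = 4 * (x * y - z * z - z - 1) + 3" unfolding D_def xy z by (simp add: algebra_simps)
    then have "D mod 4 = 3" by presburger
    then show ?thesis by simp
  qed
  then have "3 \<le> D" using \<open>0 < D\<close> by presburger
  then show ?thesis using D by simp
qed

lemma prod_ge_3_order_8:
  assumes m: "m = 4"
  shows "3 \<le> \<bar>\<Prod>i<m + 4. d i\<bar>"
proof -
  \<comment> \<open>The sign change gives a positive definite form, with the same determinant
    because the order 4 is even.\<close>
  define g where "g v w = - \<lfloor>schur v w\<rfloor>" for v w
  have g: "schur v w = - of_int (g v w)" if "v < 4" "w < 4" for v w
    using schur_int[of v w] that by (simp only: g_def m of_int_minus minus_minus)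
  have g_sym: "g v w = g w v" if "v < 4" "w < 4" for v w
    using schur_sym that by (simp add: g_def m)
  have diag: "g v v \<in> {2, 4}" if "v < 4" for v
    using schur_diag_cases[of v] schur_diag_neg[of v] that m by (auto simp: g_def)
  define y :: "int \<Rightarrow> int \<Rightarrow> int \<Rightarrow> int \<Rightarrow> nat \<Rightarrow> real" where
    "y x0 x1 x2 x3 v = of_int (if v = 0 then x0 else if v = 1 then x1 else if v = 2 then x2 else x3)" for x0 x1 x2 x3 v
  have sum4: "(\<Sum>v<4. f v) = f 0 + f 1 + f 2 + f 3" for f :: "nat \<Rightarrow> real"
    using sum_lessThan_add4[of f 0] by simp
  have pd: "pos_def_4 (g 0 0) (g 1 1) (g 2 2) (g 3 3) (g 0 1) (g 0 2) (g 0 3) (g 1 2) (g 1 3) (g 2 3)"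
    unfolding pos_def_4_def
  proof (intro allI impI)
    fix x0 x1 x2 x3 :: int
    assume "x0 \<noteq> 0 \<or> x1 \<noteq> 0 \<or> x2 \<noteq> 0 \<or> x3 \<noteq> 0"
    then have "\<exists>v<m. y x0 x1 x2 x3 v \<noteq> 0"
      unfolding m by (elim disjE) (rule exI[of _ 0] exI[of _ 1] exI[of _ 2] exI[of _ 3]; simp add: y_def)+
    then obtain v where "v < m" "y x0 x1 x2 x3 v \<noteq> 0" by blast
    then have "(\<Sum>v<m. \<Sum>w<m. schur v w * y x0 x1 x2 x3 v * y x0 x1 x2 x3 w) < 0"
      by (intro schur_negative_definite[OF i01(1,2) neg]) auto
    also have "(\<Sum>v<m. \<Sum>w<m. schur v w * y x0 x1 x2 x3 v * y x0 x1 x2 x3 w) =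
      - of_int (g 0 0 * x0 * x0 + g 1 1 * x1 * x1 + g 2 2 * x2 * x2 + g 3 3 * x3 * x3
        + 2 * (g 0 1 * x0 * x1 + g 0 2 * x0 * x2 + g 0 3 * x0 * x3 + g 1 2 * x1 * x2 + g 1 3 * x1 * x3 + g 2 3 * x2 * x3))"
      unfolding m sum4 using g_sym[of 1 0] g_sym[of 2 0] g_sym[of 3 0] g_sym[of 2 1] g_sym[of 3 1] g_sym[of 3 2]
      by (simp add: g y_def algebra_simps)
    finally show "0 < g 0 0 * x0 * x0 + g 1 1 * x1 * x1 + g 2 2 * x2 * x2 + g 3 3 * x3 * x3
        + 2 * (g 0 1 * x0 * x1 + g 0 2 * x0 * x2 + g 0 3 * x0 * x3 + g 1 2 * x1 * x2 + g 1 3 * x1 * x3 + g 2 3 * x2 * x3)"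
      by linarith
  qed
  \<comment> \<open>\<open>schur v w\<close> is -3 or -4, and -4 would make the difference of two
    basis vectors isotropic.\<close>
  have four: "g v w = 3" if vw: "v < 4" "w < 4" "v \<noteq> w" "g v v = 4" "g w w = 4" for v w
  proof -
    have "schur v v = -4" "schur w w = -4"
      using g[of v v] g[of w w] vw by simp_all
    then have eq: "schur v w = a (v + 4) (w + 4) - 4"
      using schur_both_norm_4[of v w] vw m by simp
    have "(\<Sum>x<m. \<Sum>z<m. schur x z * ((if x = v then 1 else 0) - (if x = w then 1 else 0)) * ((if z = v then 1 else 0) - (if z = w then 1 else 0))) < 0"
      using vw m by (intro schur_negative_definite[OF i01(1,2) neg, of v]) auto
    also have "(\<Sum>x<m. \<Sum>z<m. schur x z * ((if x = v then 1 else 0) - (if x = w then 1 else 0)) * ((if z = v then 1 else 0) - (if z = w then 1 else 0)))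
      = schur v v - schur v w - schur w v + schur w w"
    proof -
      have "(\<Sum>z<m. schur x z * ((if x = v then 1 else 0) - (if x = w then 1 else 0)) * ((if z = v then 1 else 0) - (if z = w then 1 else 0)))
        = (schur x v - schur x w) * ((if x = v then 1 else 0) - (if x = w then 1 else 0))" for x
        using vw m by (simp add: right_diff_distrib sum_subtractf if_distrib[of "\<lambda>c. _ * c"] cong: if_cong)
      then show ?thesis
        using vw m by (simp add: right_diff_distrib sum_subtractf if_distrib[of "\<lambda>c. _ * c"] cong: if_cong)
    qed
    finally have "-4 < schur v w"
      using \<open>schur v v = -4\<close> \<open>schur w w = -4\<close> schur_sym[of v w] vw m by simp
    then have "schur v w = -3"
      using eq zero_one[of "v + 4" "w + 4"] vw m by auto
    then show ?thesis using g[of v w] vw by simp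
  qed
  define D where "D = gram_det (g 0 0) (g 1 1) (g 2 2) (g 3 3) (g 0 1) (g 0 2) (g 0 3) (g 1 2) (g 1 3) (g 2 3)"
  have "D \<notin> {1, 2}"
    unfolding D_def by (rule gram_det_not_1_2[OF pd]) (auto intro!: four diag simp del: insert_iff)
  moreover have "det (mat 4 4 (\<lambda>(v, w). schur v w)) = of_int D"
    unfolding det_4_mat using g_sym[of 1 0] g_sym[of 2 0] g_sym[of 3 0] g_sym[of 2 1] g_sym[of 3 1] g_sym[of 3 2]
    by (simp add: g D_def gram_det_def algebra_simps)
  then have D: "(\<Prod>i<m + 4. d i) = of_int D"
    using prod_eq_det_schur by (simp add: m)
  moreover have "0 < D"
    using prod_pos_even m D by (metis even_numeral of_int_0_less_iff)
  ultimately have "3 \<le> D" by auto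
  then show ?thesis using D by simp
qed

end

end

section \<open>Nonsingular graphs\<close>

lemma bij_betw_extend_4:
  assumes "distinct [i, k, j, l]" "{i, k, j, l} \<subseteq> {..<n}"
  shows "\<exists>p. bij_betw p {..<n} {..<n} \<and> p 0 = i \<and> p 1 = k \<and> p 2 = j \<and> p 3 = (l :: nat)"
proof -
  define xs where "xs = [i, k, j, l] @ filter (\<lambda>v. v \<notin> {i, k, j, l}) [0..<n]"
  have xs: "distinct xs" "set xs = {..<n}"
    using assms by (auto simp: xs_def)
  then have "length xs = n"
    using distinct_card[of xs] by simp
  then have "bij_betw ((!) xs) {..<n} {..<n}"
    using bij_betw_nth[OF xs(1)] xs(2) by simp
  then show ?thesis
    by (intro exI[of _ "(!) xs"]) (simp add: xs_def eval_nat_numeral)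
qed

locale nonsingular_graph =
  fixes n :: nat and E :: "nat \<Rightarrow> nat \<Rightarrow> bool"
  assumes graph: "simple_graph n E" and nonsing: "det (adj_mat n E) \<noteq> 0"
begin

text \<open>The integral copy of the adjacency matrix, from which integrality and parity of the
  determinant are read off.\<close>

definition "A = mat n n (\<lambda>(i, j). if E i j then 1 else 0 :: int)"

lemma E_sym: "i < n \<Longrightarrow> j < n \<Longrightarrow> E i j = E j i"
  and E_irrefl: "i < n \<Longrightarrow> \<not> E i i"
  using graph by (auto simp: simple_graph_def)

lemma adj_mat_eq: "adj_mat n E = map_mat of_int A"
  by (intro eq_matI) (auto simp: adj_mat_def A_def)

lemma det_adj: "det (adj_mat n E) = of_int (det A)"
  unfolding adj_mat_eq by (rule of_int_hom.hom_det)

lemma abs_det_ge_1: "1 \<le> \<bar>det (adj_mat n E)\<bar>"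
proof -
  have "1 \<le> \<bar>det A\<bar>" using nonsing det_adj by simp
  then show ?thesis unfolding det_adj by (simp flip: of_int_abs)
qed

lemma abs_det_ge_2: "odd n \<Longrightarrow> 2 \<le> \<bar>det (adj_mat n E)\<bar>"
proof -
  assume "odd n"
  then have "even (det A)"
    by (intro even_det_symmetric_odd[of _ n]) (auto simp: A_def E_sym E_irrefl)
  moreover have "det A \<noteq> 0" using nonsing det_adj by simp
  ultimately have "2 \<le> \<bar>det A\<bar>" by presburger
  then show ?thesis unfolding det_adj by (simp flip: of_int_abs)
qed

lemma no_twins:
  assumes "i < n" "j < n" "i \<noteq> j"
  shows "\<exists>k<n. E i k \<noteq> E j k"
proof (rule ccontr)
  assume "\<not> ?thesis"
  then have "row A i = row A j"
    using assms by (intro eq_vecI) (auto simp: A_def)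
  then have "det A = 0"
    using assms by (intro det_identical_rows[of _ n i j]) (auto simp: A_def)
  then show False using nonsing det_adj by simp
qed

lemma no_isolated:
  assumes "j < n"
  shows "\<exists>l<n. E j l"
proof (rule ccontr)
  assume "\<not> ?thesis"
  then have "A *\<^sub>v unit_vec n j = 0\<^sub>v n"
    using assms E_sym[OF assms] by (intro eq_vecI) (auto simp: A_def scalar_prod_def intro!: sum.neutral)
  moreover have "unit_vec n j \<noteq> (0\<^sub>v n :: int vec)"
    using assms by (auto dest: arg_cong[of _ _ "\<lambda>v. v $ j"])
  ultimately have "\<exists>v. v \<in> carrier_vec n \<and> v \<noteq> 0\<^sub>v n \<and> A *\<^sub>v v = 0\<^sub>v n"
    by (intro exI[of _ "unit_vec n j"]) simp
  then have "det A = 0"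
    using det_0_iff_vec_prod_zero[of A n] by (simp add: A_def)
  then show False using nonsing det_adj by simp
qed

text \<open>Some \<open>k\<close> is adjacent to exactly one of the two vertices, by symmetry to
  \<open>i\<close>. A neighbour \<open>l\<close> of \<open>j\<close> differs from \<open>i\<close>
  and \<open>k\<close> since \<open>j\<close> is adjacent to neither. Edges from \<open>l\<close> to
  \<open>i\<close> or \<open>k\<close> remain undecided, which is the origin of the block parameters
  \<open>s\<close> and \<open>t\<close>.\<close>

lemma two_edges:
  assumes "i < n" "j < n" "i \<noteq> j" "\<not> E i j"
  shows "\<exists>i k j l. distinct [i, k, j, l] \<and> {i, k, j, l} \<subseteq> {..<n} \<and> E i k \<and> E j l \<and> \<not> E i j \<and> \<not> E k j"
proof -
  obtain k where k: "k < n" "E i k \<noteq> E j k"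
    using no_twins[OF assms(1-3)] by blast
  have *: "\<exists>l. distinct [i, k, j, l] \<and> {i, k, j, l} \<subseteq> {..<n} \<and> E j l"
    if ij: "i < n" "j < n" "i \<noteq> j" "\<not> E i j" "E i k" "\<not> E j k" for i j
  proof -
    obtain l where "l < n" "E j l" using no_isolated[OF ij(2)] by blast
    then show ?thesis
      using ij k(1) E_sym E_irrefl by (intro exI[of _ l]) auto
  qed
  show ?thesis
  proof (cases "E i k")
    case True
    then have "\<not> E k j" "\<not> E j k" using k assms E_sym by auto
    then show ?thesis using *[of i j] assms True by metis
  next
    case False
    then have "E j k" "\<not> E k i" "\<not> E j i" using k assms E_sym by auto
    then show ?thesis using *[of j i] assms False by metis
  qed
qed

lemma num_edges_eq: "(\<Sum>i<n. \<Sum>j<n. if E i j then 1 else 0 :: real) = 2 * num_edges n E"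
proof -
  let ?U = "{(i, j). i < j \<and> j < n \<and> E i j}" and ?L = "{(i, j). j < i \<and> i < n \<and> E i j}"
  have fin: "finite ?U" "finite ?L"
    by (rule finite_subset[of _ "{..<n} \<times> {..<n}"]; auto)+
  have "(\<Sum>i<n. \<Sum>j<n. if E i j then 1 else 0 :: real) = (\<Sum>(i, j)\<in>{..<n} \<times> {..<n}. if E i j then 1 else 0)"
    by (simp add: sum.cartesian_product)
  also have "\<dots> = (\<Sum>x\<in>{..<n} \<times> {..<n}. if case_prod E x then 1 else 0)"
    by (simp add: case_prod_beta)
  also have "\<dots> = card (({..<n} \<times> {..<n}) \<inter> {x. case_prod E x})"
    by (simp add: sum.If_cases)
  also have "({..<n} \<times> {..<n}) \<inter> {x. case_prod E x} = ?U \<union> ?L"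
    using E_irrefl by auto (metis linorder_neqE_nat)
  also have "card \<dots> = card ?U + card ?L"
    using fin by (intro card_Un_disjoint) auto
  also have "card ?L = card ?U"
    using E_sym by (intro bij_betw_same_card[of "\<lambda>(i, j). (j, i)"] bij_betwI[of _ _ _ "\<lambda>(i, j). (j, i)"]) auto
  finally show ?thesis by (simp add: num_edges_def)
qed

lemma avg_degree_eq: "0 < n \<Longrightarrow> real n * avg_degree n E = 2 * num_edges n E"
  by (simp add: avg_degree_def)

lemma complete_avg_degree:
  assumes "\<And>i j. i < n \<Longrightarrow> j < n \<Longrightarrow> i \<noteq> j \<Longrightarrow> E i j" and n: "0 < n"
  shows "avg_degree n E = real n - 1"
proof -
  have "(\<Sum>i<n. \<Sum>j<n. if E i j then 1 else 0 :: real) = (\<Sum>i<n. \<Sum>j<n. 1 - (if i = j then 1 else 0))"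
    using assms E_irrefl by (intro sum.cong refl) auto
  also have "\<dots> = real n * (real n - 1)"
    by (simp add: sum_subtractf algebra_simps)
  finally have "real n * avg_degree n E = real n * (real n - 1)"
    using num_edges_eq avg_degree_eq[OF n] by simp
  then show ?thesis using n by simp
qed

end

theorem theorem2p1:
  fixes n :: nat and E :: "nat \<Rightarrow> nat \<Rightarrow> bool"
  assumes "simple_graph n E"
    and "n \<ge> 5"
    and "det (adj_mat n E) \<noteq> 0"
    and "largest_eigenvalue (adj_mat n E) \<le> 7.11"
  shows "energy (adj_mat n E) \<ge> real n - 1 + avg_degree n E"
proof -
  interpret nonsingular_graph n E
    using assms by unfold_locales
  let ?A = "adj_mat n E" and ?t = "avg_degree n E"
  have A: "?A \<in> carrier_mat n n" and A_sym: "transpose_mat ?A = ?A"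
    using E_sym by (auto simp: adj_mat_def intro!: eq_matI)
  obtain u d where basis: "eigenbasis n (\<lambda>i j. ?A $$ (i, j)) u d"
    and cp: "char_poly ?A = (\<Prod>x\<leftarrow>map d [0..<n]. [:- x, 1:])"
    using eigenbasis_exists[OF A A_sym] by blast
  interpret eigenbasis n "\<lambda>i j. ?A $$ (i, j)" u d by (rule basis)
  have a: "?A $$ (i, j) = (if E i j then 1 else 0)" if "i < n" "j < n" for i j
    using that by (simp add: adj_mat_def)
  obtain i0 where i0_max: "i0 < n" "d i0 = largest_eigenvalue ?A" and max: "\<And>i. i < n \<Longrightarrow> d i \<le> d i0"
    using largest_eigenvalue_attained[OF cp] assms(2) by auto
  have sum_a: "(\<Sum>i<n. \<Sum>j<n. ?A $$ (i, j)) = n * ?t"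
    using num_edges_eq avg_degree_eq assms(2) by (simp add: a)
  have sum_d: "(\<Sum>i<n. d i) = 0"
    using E_irrefl by (simp add: trace[symmetric] a)
  have sum_d2: "(\<Sum>i<n. (d i)\<^sup>2) = n * ?t"
    unfolding sum_squares[symmetric] sum_a[symmetric] by (intro sum.cong refl) (simp add: a)
  \<comment> \<open>The Rayleigh quotient at the all-ones vector.\<close>
  have t_le: "?t \<le> d i0"
    using quadratic_form_le[OF max, of "\<lambda>_. 1"] sum_a assms(2) by simp
  have abs_le: "\<bar>d i\<bar> \<le> d i0" if "i < n" for i
    using abs_eigenvalue_le[OF max _ that] by (simp add: a)
  have det_d: "\<bar>det ?A\<bar> = (\<Prod>i<n. \<bar>d i\<bar>)"
  proof -
    have "?A = mat n n (\<lambda>(j, k). ?A $$ (j, k))" using A by (intro eq_matI) auto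
    then have "det ?A = (\<Prod>i<n. d i)" using det_eq by simp
    then show ?thesis by (simp add: abs_prod)
  qed
  have spec: "graph_spectrum n d i0 ?t D" if "1 \<le> D" "D \<le> \<bar>det ?A\<bar>" for D
    using i0_max(1) sum_d sum_d2 that t_le abs_le det_d by unfold_locales auto
  \<comment> \<open>The value 1 is always available; orders with a better determinant bound
    interpret the locale again below.\<close>
  interpret graph_spectrum n d i0 ?t 1
    using spec abs_det_ge_1 by simp
  have r_le_711: "d i0 \<le> 711 / 100"
    using assms(4) i0_max(2) by simp
  show ?thesis
    unfolding energy_eq[OF cp]
  proof (cases "\<forall>i<n. \<forall>j<n. i \<noteq> j \<longrightarrow> E i j")
    case True
    have "d i0 \<le> \<bar>\<Sum>i\<in>{..<n} - {i0}. d i\<bar>"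
      using sum_split[of d] sum_d by simp
    also have "\<dots> \<le> (\<Sum>i\<in>{..<n} - {i0}. \<bar>d i\<bar>)"
      by (rule sum_abs)
    finally have "2 * d i0 \<le> (\<Sum>i<n. \<bar>d i\<bar>)"
      using sum_split[of "\<lambda>i. \<bar>d i\<bar>"] by simp
    moreover have "?t = real n - 1"
      using complete_avg_degree True assms(2) by simp
    ultimately show "real n - 1 + ?t \<le> (\<Sum>i<n. \<bar>d i\<bar>)"
      using t_le by simp
  next
    case False
    then obtain i k j l where ikjl: "distinct [i, k, j, l]" "{i, k, j, l} \<subseteq> {..<n}"
      "E i k" "E j l" "\<not> E i j" "\<not> E k j"
      using two_edges by metis
    then obtain p where p: "bij_betw p {..<n} {..<n}" "p 0 = i" "p 1 = k" "p 2 = j" "p 3 = l"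
      using bij_betw_extend_4 by blast
    define m where "m = n - 4"
    have m: "m + 4 = n" using assms(2) by (simp add: m_def)
    have p_less: "p v < n" if "v < n" for v
      using bij_betwE[OF p(1)] that by auto
    have p_a: "?A $$ (p v, p w) = (if E (p v) (p w) then 1 else 0)" if "v < n" "w < n" for v w
      using a p_less that by simp
    interpret P: block_graph_eigenbasis m "\<lambda>v w. ?A $$ (p v, p w)" "\<lambda>i v. u i (p v)" d
      "?A $$ (i, l)" "?A $$ (k, l)"
    proof -
      have "eigenbasis (m + 4) (\<lambda>v w. ?A $$ (p v, p w)) (\<lambda>i v. u i (p v)) d"
        unfolding m by (rule permute[OF p(1)])
      then show "block_graph_eigenbasis m (\<lambda>v w. ?A $$ (p v, p w)) (\<lambda>i v. u i (p v)) d (?A $$ (i, l)) (?A $$ (k, l))"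
        unfolding block_graph_eigenbasis_def block_graph_eigenbasis_axioms_def
          block_eigenbasis_def block_eigenbasis_axioms_def
        using ikjl p(2-) E_irrefl p_less by (simp add: a m)
    qed
    have pos1: "1 \<le> card {i. i < n \<and> i \<noteq> i0 \<and> 0 < d i}"
    proof -
      have "{i. i < n \<and> i \<noteq> i0 \<and> 0 < d i} \<noteq> {}"
        using P.second_positive[unfolded m, OF i0_max(1)] by blast
      then show ?thesis
        by (simp add: Suc_le_eq card_gt_0_iff)
    qed
    \<comment> \<open>Besides the largest eigenvalue exactly one is positive here, which makes the
      Schur complement negative definite.\<close>
    have det_ge_3: "3 \<le> \<bar>det ?A\<bar>" if n: "n = 6 \<or> n = 8" and few: "\<not> 2 \<le> card {i. i < n \<and> i \<noteq> i0 \<and> 0 < d i}"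
    proof -
      have "card {i. i < n \<and> i \<noteq> i0 \<and> 0 < d i} = 1"
        using pos1 few by linarith
      then obtain i1 where i1: "{i. i < n \<and> i \<noteq> i0 \<and> 0 < d i} = {i1}"
        by (auto simp: card_1_singleton_iff)
      have i1': "i1 < m + 4" "i0 \<noteq> i1" "0 < d i1" using i1 m by auto
      have neg: "d i < 0" if "i < m + 4" "i \<noteq> i0" "i \<noteq> i1" for i
        using i1 nonzero[of i] that m by (metis (mono_tags, lifting) mem_Collect_eq singletonD linorder_neqE_linordered_idom)
      have i0': "i0 < m + 4" "0 < d i0" using i0_max m r_ge_1 by auto
      have "m = 2 \<or> m = 4" using n m by auto
      then have "3 \<le> \<bar>\<Prod>i<m + 4. d i\<bar>"
        using P.prod_ge_3_order_6[OF i0'(1) i1'(1,2) i0'(2) i1'(3) neg] P.prod_ge_3_order_8[OF i0'(1) i1'(1,2) i0'(2) i1'(3) neg]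
        by blast
      then show ?thesis by (simp add: det_d m abs_prod)
    qed
    consider "n = 5" | "n = 6" | "n = 7" | "n = 8" | "n = 9" | "n = 10" | "11 \<le> n"
      using assms(2) by linarith
    then show "real n - 1 + ?t \<le> (\<Sum>i<n. \<bar>d i\<bar>)"
    proof cases
      case 1
      interpret S: graph_spectrum n d i0 ?t 2 by (rule spec) (use abs_det_ge_2 1 in auto)
      show ?thesis by (rule S.energy_ge_order_5[OF 1 refl pos1])
    next
      case 2
      show ?thesis
      proof (cases "2 \<le> card {i. i < n \<and> i \<noteq> i0 \<and> 0 < d i}")
        case True
        then show ?thesis by (rule energy_ge_order_6_two[OF 2 refl _])
      next
        case False
        interpret S: graph_spectrum n d i0 ?t 3 by (rule spec) (use det_ge_3 2 False in auto)
        show ?thesis by (rule S.energy_ge_order_6_one[OF 2 refl pos1])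
      qed
    next
      case 3
      interpret S: graph_spectrum n d i0 ?t 2 by (rule spec) (use abs_det_ge_2 3 in auto)
      show ?thesis by (rule S.energy_ge_order_7[OF 3 refl pos1])
    next
      case 4
      show ?thesis
      proof (cases "2 \<le> card {i. i < n \<and> i \<noteq> i0 \<and> 0 < d i}")
        case True
        then show ?thesis by (rule energy_ge_order_8_two[OF 4 refl _])
      next
        case False
        interpret S: graph_spectrum n d i0 ?t 3 by (rule spec) (use det_ge_3 4 False in auto)
        show ?thesis by (rule S.energy_ge_order_8_one[OF 4 refl pos1])
      qed
    next
      case 5
      interpret S: graph_spectrum n d i0 ?t 2 by (rule spec) (use abs_det_ge_2 5 in auto)
      show ?thesis by (rule S.energy_ge_order_9[OF 5 refl pos1 r_le_711])
    next
      case 6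
      show ?thesis by (rule energy_ge_order_10[OF 6 refl pos1 r_le_711])
    next
      case 7
      then show ?thesis using energy_ge_large_order r_le_711 by simp
    qed
  qed
qed

end
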